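(* Let $H$ satisfy the embedding conditions below with constant $C_H$ and with $h$ a strictly positive probability density w.r.t. $\mu$, and let $f\in H$. Let $0<\alpha<1$, $w=\alpha w_m+(1-\alpha)h$, $\nu=w\mu$, $n>m$, and $\mathbf x\sim\gamma_n^\nu$, using weighted least squares with weight $w$; let $0<\delta<1$. Then with probability at least $1-m\exp(-c_\delta(n-m)\alpha/m)$, $$\|f-\hat P_{V_m}f\|\le\Big(C_H+(1-\delta)^{-1/2}(1-\alpha)^{-1/2}\big(1-\tfrac mn\big)^{-1/2}\Big)\inf_{g\in V_m}\|f-g\|_H.$$ Moreover, if $n\ge m+c_\delta^{-1}\alpha^{-1}m\log(nm^2)$, then $$\mathbb E(\|f-\hat P_{V_m}f\|^2)\le\Big(2C_H^2+2(1-\alpha)^{-1}\big(1+(1-\delta)^{-1}(1-\tfrac mn)^{-1}\big)\Big)\inf_{g\in V_m}\|f-g\|_H^2.$$ (Convention $\|v\|_H=+\infty$ for $v\notin H$.)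
   Context: $\mathcal X$ is a Polish space with Borel probability measure $\mu$; $\|\cdot\|$ is the $L^2_\mu$ norm. $V_m\subset L^2_\mu$ has $L^2_\mu$-orthonormal basis $\varphi_1,\dots,\varphi_m$, $\boldsymbol\varphi=(\varphi_1,\dots,\varphi_m)^T$, $w_m(x)=\frac1m\|\boldsymbol\varphi(x)\|_2^2$. For points $\mathbf x=(x_1,\dots,x_n)$ and weight $w$: $\|f\|_n^2=\frac1n\sum_iw(x_i)^{-1}f(x_i)^2$; $\Phi^w(\mathbf x)$ has rows $w(x_i)^{-1/2}\boldsymbol\varphi(x_i)^T$; $\mathbf G^w(\mathbf x)=\frac1n\Phi^w(\mathbf x)^T\Phi^w(\mathbf x)$; $\hat P_{V_m}f$ is the unique minimizer over $V_m$ of $\|f-g\|_n$. $\gamma_n^\nu$ is the probability measure on $\mathcal X^n$ with $d\gamma_n^\nu(\mathbf x)=\frac{(n-m)!}{n!}\det(\Phi^w(\mathbf x)^T\Phi^w(\mathbf x))\,d\nu^{\otimes n}(\mathbf x)$. $c_\delta=\delta+(1-\delta)\log(1-\delta)$. $H$ is a normed vector space of functions on $\mathcal X$ with $\|f\|\le C_H\|f\|_H$ and $\operatorname{ess\,sup}_xh(x)^{-1/2}|f(x)|\le\|f\|_H$ for all $f\in H$. *)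

theory Defs
  imports "HOL-Probability.Probability"
begin

definition L2 :: "'a measure \<Rightarrow> ('a \<Rightarrow> real) set" where
  "L2 M = {f. f \<in> borel_measurable M \<and> integrable M (\<lambda>x. (f x)^2)}"

definition L2norm :: "'a measure \<Rightarrow> ('a \<Rightarrow> real) \<Rightarrow> real" where
  "L2norm M f = sqrt (\<integral>x. (f x)^2 \<partial>M)"

definition orthonormal_L2 :: "'a measure \<Rightarrow> nat \<Rightarrow> (nat \<Rightarrow> 'a \<Rightarrow> real) \<Rightarrow> bool" where
  "orthonormal_L2 M m \<phi> \<longleftrightarrow> (\<forall>i<m. \<phi> i \<in> L2 M) \<and>
     (\<forall>i<m. \<forall>j<m. (\<integral>x. \<phi> i x * \<phi> j x \<partial>M) = (if i = j then 1 else 0))"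

definition Vspace :: "nat \<Rightarrow> (nat \<Rightarrow> 'a \<Rightarrow> real) \<Rightarrow> ('a \<Rightarrow> real) set" where
  "Vspace m \<phi> = {g. \<exists>c::nat \<Rightarrow> real. g = (\<lambda>x. \<Sum>i<m. c i * \<phi> i x)}"

definition wm :: "nat \<Rightarrow> (nat \<Rightarrow> 'a \<Rightarrow> real) \<Rightarrow> 'a \<Rightarrow> real" where
  "wm m \<phi> x = (1 / real m) * (\<Sum>i<m. (\<phi> i x)^2)"

definition emp_sqnorm :: "nat \<Rightarrow> ('a \<Rightarrow> real) \<Rightarrow> (nat \<Rightarrow> 'a) \<Rightarrow> ('a \<Rightarrow> real) \<Rightarrow> real" where
  "emp_sqnorm n w xs f = (1 / real n) * (\<Sum>i<n. (f (xs i))^2 / w (xs i))"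

definition wls_proj :: "nat \<Rightarrow> nat \<Rightarrow> (nat \<Rightarrow> 'a \<Rightarrow> real) \<Rightarrow> ('a \<Rightarrow> real) \<Rightarrow> (nat \<Rightarrow> 'a)
    \<Rightarrow> ('a \<Rightarrow> real) \<Rightarrow> ('a \<Rightarrow> real)" where
  "wls_proj n m \<phi> w xs f = (THE g. g \<in> Vspace m \<phi> \<and>
     (\<forall>g'\<in>Vspace m \<phi>. emp_sqnorm n w xs (\<lambda>x. f x - g x) \<le> emp_sqnorm n w xs (\<lambda>x. f x - g' x)))"

text \<open>Entries of the matrix Phi^w(xs): row k, column i.\<close>
definition Phi :: "(nat \<Rightarrow> 'a \<Rightarrow> real) \<Rightarrow> ('a \<Rightarrow> real) \<Rightarrow> (nat \<Rightarrow> 'a) \<Rightarrow> nat \<Rightarrow> nat \<Rightarrow> real" where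
  "Phi \<phi> w xs k i = w (xs k) powr (-1/2) * \<phi> i (xs k)"

definition det_nat :: "nat \<Rightarrow> (nat \<Rightarrow> nat \<Rightarrow> real) \<Rightarrow> real" where
  "det_nat m A = (\<Sum>p | p permutes {..<m}. of_int (sign p) * (\<Prod>i<m. A i (p i)))"

definition gamma_n :: "nat \<Rightarrow> nat \<Rightarrow> (nat \<Rightarrow> 'a \<Rightarrow> real) \<Rightarrow> ('a \<Rightarrow> real) \<Rightarrow> 'a measure
    \<Rightarrow> (nat \<Rightarrow> 'a) measure" where
  "gamma_n n m \<phi> w \<nu> = density (PiM {..<n} (\<lambda>_. \<nu>))
     (\<lambda>xs. ennreal ((fact (n - m) / fact n :: real) *
        det_nat m (\<lambda>i j. \<Sum>k<n. Phi \<phi> w xs k i * Phi \<phi> w xs k j)))"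

definition c_delta :: "real \<Rightarrow> real" where
  "c_delta \<delta> = \<delta> + (1 - \<delta>) * ln (1 - \<delta>)"

definition embedding_space :: "'a measure \<Rightarrow> ('a \<Rightarrow> real) set \<Rightarrow> (('a \<Rightarrow> real) \<Rightarrow> real)
    \<Rightarrow> real \<Rightarrow> ('a \<Rightarrow> real) \<Rightarrow> bool" where
  "embedding_space M H nH C h \<longleftrightarrow>
     H \<subseteq> L2 M \<and>
     (\<lambda>x. 0) \<in> H \<and>
     (\<forall>f\<in>H. \<forall>g\<in>H. (\<lambda>x. f x + g x) \<in> H) \<and>
     (\<forall>f\<in>H. \<forall>c. (\<lambda>x. c * f x) \<in> H) \<and>
     (\<forall>f\<in>H. 0 \<le> nH f) \<and>
     (\<forall>f\<in>H. \<forall>c. nH (\<lambda>x. c * f x) = \<bar>c\<bar> * nH f) \<and>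
     (\<forall>f\<in>H. \<forall>g\<in>H. nH (\<lambda>x. f x + g x) \<le> nH f + nH g) \<and>
     (\<forall>f\<in>H. nH f = 0 \<longrightarrow> (AE x in M. f x = 0)) \<and>
     (\<forall>f\<in>H. L2norm M f \<le> C * nH f) \<and>
     (\<forall>f\<in>H. esssup M (\<lambda>x. ereal (h x powr (-1/2) * \<bar>f x\<bar>)) \<le> ereal (nH f))"

definition distH :: "('a \<Rightarrow> real) set \<Rightarrow> (('a \<Rightarrow> real) \<Rightarrow> real) \<Rightarrow> ('a \<Rightarrow> real) set
    \<Rightarrow> ('a \<Rightarrow> real) \<Rightarrow> ennreal" where
  "distH H nH V f = (INF g\<in>V. if (\<lambda>x. f x - g x) \<in> H then ennreal (nH (\<lambda>x. f x - g x)) else \<infinity>)"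

end

theory Submission
  imports Defs "Jordan_Normal_Form.Determinant" "HOL-Real_Asymp.Real_Asymp"
begin

text \<open>
  Under \<open>\<nu>\<close> the weighted features \<open>v(x) = w(x)\<^sup>-\<^sup>1\<^sup>/\<^sup>2 \<phi>(x)\<close> are isotropic and bounded by \<open>|v|\<^sup>2 \<le> m/\<alpha>\<close>.
  By the Cauchy--Binet formula, \<open>\<gamma>\<close> is a mixture over \<open>m\<close>-subsets of the points: the chosen points follow a
  determinantal law and the other \<open>n - m\<close> are independent with law \<open>\<nu>\<close>, so a matrix Chernoff bound for the latter
  controls the smallest eigenvalue of the whole Gram matrix. Where it is at least \<open>(1-\<delta>)(n-m)\<close>, the error of
  the projection is bounded deterministically. Elsewhere one uses \<open>\<lambda>\<^sub>m\<^sub>i\<^sub>n\<^sup>-\<^sup>1 \<le> tr M\<^sup>-\<^sup>1\<close>: multiplied by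
  the density, \<open>det M tr M\<^sup>-\<^sup>1\<close> is a sum of Gram determinants of \<open>m - 1\<close> columns, to which the same argument applies.

  The Chernoff bound is derived without matrix exponentials, by following the trace of
  \<open>(K I - \<Sum> v v\<^sup>T)\<^sup>p\<close> with \<open>K = p/\<theta>\<close> and letting \<open>p \<rightarrow> \<infinity>\<close>.
\<close>

section \<open>Moments and traces of powers of positive semidefinite operators\<close>

text \<open>The polynomial (1 - \<theta> A / p)^p stands in for the exponential of -\<theta> A. It
  needs no spectral theorem: what the exponential would give is read off the moments
  \<open>ip m x ((T ^^ j) x)\<close>, which form a log-convex sequence when T is positive
  semidefinite. The number of vectors stays fixed while p and K grow, so all operators on the way
  are eventually positive, and the losses from crude bounds vanish in the limit. Only n - m points
  stay independent under \<gamma>, so eigenvalues are compared with (1 - \<delta>)(n - m) instead of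
  (1 - \<delta>) n; this is the origin of the factor 1 / (1 - m/n). The logarithmic condition on n
  makes the contribution of the bad event, measured by n tr M^(-1), at most 1, hence the summand 1
  in the second constant. The infimum over V_m need not be attained, so both estimates are proved
  along approximants and passed to the limit.\<close>

definition ip :: "nat \<Rightarrow> (nat \<Rightarrow> real) \<Rightarrow> (nat \<Rightarrow> real) \<Rightarrow> real" where
  "ip m x y = (\<Sum>i<m. x i * y i)"

definition unit_vec_at :: "nat \<Rightarrow> nat \<Rightarrow> real" where
  "unit_vec_at i = (\<lambda>j. if j = i then 1 else 0)"

lemma ip_commute: "ip m x y = ip m y x"
  by (simp add: ip_def mult.commute)

lemma ip_add_left: "ip m (\<lambda>i. x i + y i) z = ip m x z + ip m y z"
  by (simp add: ip_def sum.distrib algebra_simps)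

lemma ip_add_right: "ip m z (\<lambda>i. x i + y i) = ip m z x + ip m z y"
  by (simp add: ip_def sum.distrib algebra_simps)

lemma ip_scale_left: "ip m (\<lambda>i. c * x i) z = c * ip m x z"
  by (simp add: ip_def sum_distrib_left algebra_simps)

lemma ip_scale_right: "ip m z (\<lambda>i. c * x i) = c * ip m z x"
  by (simp add: ip_def sum_distrib_left algebra_simps)

lemma ip_sum_right: "ip m z (\<lambda>i. \<Sum>k\<in>A. f k i) = (\<Sum>k\<in>A. ip m z (f k))"
  unfolding ip_def sum_distrib_left by (rule sum.swap)

lemma ip_self_nonneg: "0 \<le> ip m x x"
  by (simp add: ip_def sum_nonneg)

lemma ip_Cauchy_Schwarz: "(ip m x y)\<^sup>2 \<le> ip m x x * ip m y y"
  using Cauchy_Schwarz_ineq_sum[of x y "{..<m}"] by (simp add: ip_def power2_eq_square)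

lemma ip_unit_vec_at: "i < m \<Longrightarrow> ip m (unit_vec_at i) x = x i"
  by (simp add: ip_def unit_vec_at_def if_distrib[of "\<lambda>t. t * _"] cong: if_cong)

text \<open>Common source of the Cauchy-Schwarz inequalities for the form of a positive operator and
  for the L2 product. Neither form is definite, so c = 0 is a genuine case: there a linear function
  of t is nonnegative, and t is chosen to refute a nonzero slope.\<close>

lemma discriminant_from_nonneg:
  fixes a b c :: real
  assumes nonneg: "\<And>t. 0 \<le> a + 2 * t * b + t\<^sup>2 * c" and "0 \<le> c"
  shows "b\<^sup>2 \<le> a * c"
proof (cases "c = 0")
  case True
  have "b = 0"
  proof (rule ccontr)
    assume b: "b \<noteq> 0"
    have "0 \<le> a + 2 * (- (\<bar>a\<bar> + 1) / b) * b"
      using nonneg[of "- (\<bar>a\<bar> + 1) / b"] True by simp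
    also have "\<dots> = a - 2 * (\<bar>a\<bar> + 1)" using b by (simp add: field_simps)
    finally show False by simp
  qed
  then show ?thesis using True by simp
next
  case False
  then have c: "c > 0" using assms by simp
  have "0 \<le> a + 2 * (- b / c) * b + (- b / c)\<^sup>2 * c" by (rule nonneg)
  also have "\<dots> = a - b\<^sup>2 / c" using c by (simp add: power2_eq_square field_simps)
  finally show ?thesis using c by (simp add: field_simps)
qed

text \<open>The ratios a(j+1) / a(j) of a log-convex sequence increase; the cross-multiplied form
  tolerates zeros.\<close>

lemma log_convex_seq_cross:
  fixes a :: "nat \<Rightarrow> real"
  assumes nonneg: "\<And>j. 0 \<le> a j" and lc: "\<And>j. (a (Suc j))\<^sup>2 \<le> a j * a (Suc (Suc j))"
    and "i \<le> j"
  shows "a (Suc i) * a j \<le> a i * a (Suc j)"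
  using \<open>i \<le> j\<close>
proof (induction j rule: dec_induct)
  case base
  then show ?case by simp
next
  case (step j)
  show ?case
  proof (cases "a (Suc j) = 0")
    case True
    then show ?thesis using nonneg by simp
  next
    case False
    then have pos1: "a (Suc j) > 0" using nonneg[of "Suc j"] by simp
    have "a j \<noteq> 0" using lc[of j] pos1 by auto
    then have pos: "a j > 0" using nonneg[of j] by simp
    have "(a (Suc i) * a (Suc j)) * a j \<le> a i * (a (Suc j))\<^sup>2"
      using mult_right_mono[OF step.IH, of "a (Suc j)"] pos1 by (simp add: power2_eq_square mult_ac)
    also have "\<dots> \<le> a i * (a j * a (Suc (Suc j)))"
      by (rule mult_left_mono[OF lc nonneg])
    finally show ?thesis using pos by (simp add: mult_ac)
  qed
qed

text \<open>Moving one unit from the smaller index to the larger one does not decrease the product,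
  and this can be repeated until the smaller index is 0.\<close>

lemma log_convex_seq_supermult:
  fixes a :: "nat \<Rightarrow> real"
  assumes nonneg: "\<And>j. 0 \<le> a j" and lc: "\<And>j. (a (Suc j))\<^sup>2 \<le> a j * a (Suc (Suc j))"
  shows "a i * a j \<le> a 0 * a (i + j)"
proof -
  have le: "i \<le> j \<Longrightarrow> a i * a j \<le> a 0 * a (i + j)" for i j
  proof (induction i arbitrary: j)
    case (Suc i)
    have "a (Suc i) * a j \<le> a i * a (Suc j)"
      using log_convex_seq_cross[of a i j] nonneg lc Suc.prems by simp
    also have "\<dots> \<le> a 0 * a (i + Suc j)" by (rule Suc.IH) (use Suc.prems in simp)
    finally show ?case by simp
  qed simp
  show ?thesis
    using le[of i j] le[of j i] by (cases "i \<le> j") (simp_all add: mult.commute add.commute)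
qed

definition trace_pow :: "nat \<Rightarrow> ((nat \<Rightarrow> real) \<Rightarrow> nat \<Rightarrow> real) \<Rightarrow> nat \<Rightarrow> real" where
  "trace_pow m T p = (\<Sum>i<m. ip m (unit_vec_at i) ((T ^^ p) (unit_vec_at i)))"

text \<open>The form i + i matches the split of an even power as T^i applied to both sides of the
  inner product.\<close>

lemma nat_double_cases:
  obtains i where "(j::nat) = i + i" | i where "j = Suc (i + i)"
  by (metis add_Suc_right even_iff_mod_2_eq_zero mult_2 oddE Suc_eq_plus1 evenE)

text \<open>Operators act on whole sequences, but symmetry and positivity are tested only through
  the first m coordinates seen by \<open>ip m\<close>.\<close>

locale psd_operator =
  fixes m :: nat and T :: "(nat \<Rightarrow> real) \<Rightarrow> nat \<Rightarrow> real"
  assumes add: "T (\<lambda>i. x i + y i) = (\<lambda>i. T x i + T y i)"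
    and scale: "T (\<lambda>i. c * x i) = (\<lambda>i. c * T x i)"
    and sym: "ip m x (T y) = ip m (T x) y"
    and pos: "0 \<le> ip m x (T x)"
begin

lemma funpow_sym: "ip m x ((T ^^ j) y) = ip m ((T ^^ j) x) y"
proof (induction j arbitrary: x y)
  case (Suc j)
  then show ?case by (metis funpow.simps(2) funpow_swap1 o_apply sym)
qed simp

lemma ip_funpow_split: "ip m ((T ^^ i) x) ((T ^^ j) y) = ip m x ((T ^^ (i + j)) y)"
  by (simp add: funpow_add flip: funpow_sym)

lemma form_Cauchy_Schwarz: "(ip m x (T y))\<^sup>2 \<le> ip m x (T x) * ip m y (T y)"
proof (rule discriminant_from_nonneg)
  fix t :: real
  have "0 \<le> ip m (\<lambda>i. x i + t * y i) (T (\<lambda>i. x i + t * y i))" by (rule pos)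
  also have "\<dots> = ip m x (T x) + 2 * t * ip m x (T y) + t\<^sup>2 * ip m y (T y)"
    using sym[of y x] ip_commute[of m "T y" x]
    by (simp add: add scale ip_add_left ip_add_right ip_scale_left ip_scale_right
        power2_eq_square algebra_simps)
  finally show "0 \<le> ip m x (T x) + 2 * t * ip m x (T y) + t\<^sup>2 * ip m y (T y)" .
qed (rule pos)

lemma moment_even: "ip m x ((T ^^ (i + i)) x) = ip m ((T ^^ i) x) ((T ^^ i) x)"
  by (simp add: ip_funpow_split)

lemma moment_odd: "ip m x ((T ^^ Suc (i + i)) x) = ip m ((T ^^ i) x) (T ((T ^^ i) x))"
  using ip_funpow_split[of i x "Suc i" x] by simp

lemma moment_nonneg: "0 \<le> ip m x ((T ^^ j) x)"
  by (cases j rule: nat_double_cases)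
    (simp_all only: moment_even moment_odd ip_self_nonneg pos)

text \<open>For even j the outer moments are the squared lengths of T^i x and T^(i+1) x, and the
  plain Cauchy-Schwarz inequality applies; for odd j they are values of the form of T at these two
  vectors, and \<open>form_Cauchy_Schwarz\<close> applies.\<close>

lemma moment_log_convex:
  "(ip m x ((T ^^ Suc j) x))\<^sup>2 \<le> ip m x ((T ^^ j) x) * ip m x ((T ^^ Suc (Suc j)) x)"
proof (cases j rule: nat_double_cases)
  case (1 i)
  have "Suc (Suc j) = Suc i + Suc i" using 1 by simp
  then show ?thesis
    using ip_Cauchy_Schwarz[of m "(T ^^ i) x" "(T ^^ Suc i) x"]
    unfolding 1 by (simp only: moment_even moment_odd) simp
next
  case (2 i)
  have e: "Suc j = Suc i + Suc i" "Suc (Suc j) = Suc (Suc i + Suc i)" using 2 by simp_all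
  have "ip m ((T ^^ Suc i) x) ((T ^^ Suc i) x) = ip m ((T ^^ i) x) (T ((T ^^ Suc i) x))"
    by (simp add: sym)
  then show ?thesis
    using form_Cauchy_Schwarz[of "(T ^^ i) x" "(T ^^ Suc i) x"]
    unfolding e unfolding 2 by (simp only: moment_even moment_odd)
qed

lemma moment_supermult:
  "ip m x ((T ^^ i) x) * ip m x ((T ^^ j) x) \<le> ip m x x * ip m x ((T ^^ (i + j)) x)"
  using log_convex_seq_supermult[of "\<lambda>j. ip m x ((T ^^ j) x)" i j]
  by (simp add: moment_nonneg moment_log_convex del: funpow.simps(2))

lemma moment_Suc_ge:
  assumes low: "b * ip m x x \<le> ip m x (T x)"
  shows "b * ip m x ((T ^^ j) x) \<le> ip m x ((T ^^ Suc j) x)"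
proof (cases "ip m x x = 0")
  case True
  have "(ip m x ((T ^^ j) x))\<^sup>2 \<le> 0"
    using ip_Cauchy_Schwarz[of m x "(T ^^ j) x"] True by simp
  then show ?thesis using moment_nonneg[of x "Suc j"] by simp
next
  case False
  then have xx: "0 < ip m x x" using ip_self_nonneg[of m x] by simp
  have "(b * ip m x ((T ^^ j) x)) * ip m x x \<le> ip m x (T x) * ip m x ((T ^^ j) x)"
    using mult_right_mono[OF low moment_nonneg[of x j]] by (simp add: mult_ac)
  also have "\<dots> \<le> ip m x ((T ^^ Suc j) x) * ip m x x"
    using moment_supermult[of x 1 j] by (simp add: mult_ac)
  finally show ?thesis using xx mult_le_cancel_right_pos by blast
qed

lemma moment_ge_power:
  assumes "b * ip m x x \<le> ip m x (T x)" "0 \<le> b"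
  shows "b ^ j * ip m x x \<le> ip m x ((T ^^ j) x)"
proof (induction j)
  case (Suc j)
  have "b ^ Suc j * ip m x x \<le> b * ip m x ((T ^^ j) x)"
    using mult_left_mono[OF Suc assms(2)] by (simp add: mult_ac)
  also have "\<dots> \<le> ip m x ((T ^^ Suc j) x)" by (rule moment_Suc_ge[OF assms(1)])
  finally show ?case .
qed simp

text \<open>Here the bound must hold for all vectors, since it is applied at iterates of x. For odd
  j the claim is |Tu|^2 \<le> K <u, Tu>: Cauchy-Schwarz for the form of T at u and Tu bounds |Tu|^4,
  and one factor |Tu|^2 cancels.\<close>

lemma moment_Suc_le:
  assumes up: "\<And>y. ip m y (T y) \<le> K * ip m y y" and "0 \<le> K"
  shows "ip m x ((T ^^ Suc j) x) \<le> K * ip m x ((T ^^ j) x)"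
proof (cases j rule: nat_double_cases)
  case (1 i)
  then show ?thesis unfolding 1 by (simp only: moment_even moment_odd up)
next
  case (2 i)
  define u where "u = (T ^^ i) x"
  have e: "Suc j = Suc i + Suc i" using 2 by simp
  have "(ip m (T u) (T u))\<^sup>2 = (ip m u (T (T u)))\<^sup>2" by (simp add: sym)
  also have "\<dots> \<le> ip m u (T u) * ip m (T u) (T (T u))" by (rule form_Cauchy_Schwarz)
  also have "\<dots> \<le> ip m u (T u) * (K * ip m (T u) (T u))"
    by (rule mult_left_mono[OF up pos])
  finally have "ip m (T u) (T u) * ip m (T u) (T u) \<le> (K * ip m u (T u)) * ip m (T u) (T u)"
    by (simp add: power2_eq_square mult_ac)
  then have "ip m (T u) (T u) \<le> K * ip m u (T u)"
    using ip_self_nonneg[of m "T u"] pos[of u] \<open>0 \<le> K\<close>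
    by (cases "ip m (T u) (T u) = 0") (simp_all add: mult_le_cancel_right)
  moreover have "ip m x ((T ^^ Suc j) x) = ip m (T u) (T u)"
    unfolding e moment_even u_def by simp
  ultimately show ?thesis unfolding 2 moment_odd u_def[symmetric] by simp
qed

lemma trace_pow_nonneg: "0 \<le> trace_pow m T p"
  unfolding trace_pow_def by (intro sum_nonneg moment_nonneg)

text \<open>Substitute for bounding the largest eigenvalue of an even power by its trace: the
  coordinates of T^i x are inner products of x with the T^i e_l, and the squared lengths of the T^i
  e_l sum to the trace of T^(i+i).\<close>

lemma moment_even_le_trace: "ip m x ((T ^^ (i + i)) x) \<le> ip m x x * trace_pow m T (i + i)"
proof -
  have "ip m x ((T ^^ (i + i)) x) = (\<Sum>l<m. ((T ^^ i) x l)\<^sup>2)"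
    unfolding moment_even by (simp add: ip_def power2_eq_square)
  also have "\<dots> = (\<Sum>l<m. (ip m x ((T ^^ i) (unit_vec_at l)))\<^sup>2)"
    by (intro sum.cong refl arg_cong[of _ _ "\<lambda>t. t\<^sup>2"])
      (metis funpow_sym ip_commute ip_unit_vec_at lessThan_iff)
  also have "\<dots> \<le> (\<Sum>l<m. ip m x x * ip m ((T ^^ i) (unit_vec_at l)) ((T ^^ i) (unit_vec_at l)))"
    by (intro sum_mono ip_Cauchy_Schwarz)
  also have "\<dots> = ip m x x * trace_pow m T (i + i)"
    unfolding trace_pow_def moment_even by (simp add: sum_distrib_left)
  finally show ?thesis .
qed

lemma trace_pow_Suc_le:
  assumes "\<And>y. ip m y (T y) \<le> K * ip m y y" and "0 \<le> K"
  shows "trace_pow m T (Suc p) \<le> K * trace_pow m T p"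
  unfolding trace_pow_def sum_distrib_left
  by (intro sum_mono moment_Suc_le assms)

end

section \<open>Shifted Gram operators and rank-one downdates\<close>

definition shifted_gram ::
  "nat \<Rightarrow> real \<Rightarrow> 'k set \<Rightarrow> ('k \<Rightarrow> nat \<Rightarrow> real) \<Rightarrow> (nat \<Rightarrow> real) \<Rightarrow> nat \<Rightarrow> real" where
  "shifted_gram m K I v x = (\<lambda>i. K * x i - (\<Sum>k\<in>I. ip m (v k) x * v k i))"

text \<open>The operator T - s u u^T. The parameter s turns the addition of one vector into a
  differentiable path from s = 0 to s = 1.\<close>

definition downdate ::
  "nat \<Rightarrow> (nat \<Rightarrow> real) \<Rightarrow> real \<Rightarrow> ((nat \<Rightarrow> real) \<Rightarrow> nat \<Rightarrow> real) \<Rightarrow> (nat \<Rightarrow> real) \<Rightarrow> nat \<Rightarrow> real" where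
  "downdate m u s T x = (\<lambda>i. T x i - s * ip m u x * u i)"

lemma shifted_gram_add:
  "shifted_gram m K I v (\<lambda>i. x i + y i) = (\<lambda>i. shifted_gram m K I v x i + shifted_gram m K I v y i)"
  by (rule ext) (simp add: shifted_gram_def ip_add_right sum.distrib algebra_simps)

lemma shifted_gram_scale:
  "shifted_gram m K I v (\<lambda>i. c * x i) = (\<lambda>i. c * shifted_gram m K I v x i)"
  by (rule ext) (simp add: shifted_gram_def ip_scale_right sum_distrib_left algebra_simps)

lemma ip_shifted_gram:
  "ip m y (shifted_gram m K I v x) = K * ip m y x - (\<Sum>k\<in>I. ip m (v k) x * ip m (v k) y)"
proof -
  have e: "shifted_gram m K I v x = (\<lambda>i. K * x i + (-1) * (\<Sum>k\<in>I. ip m (v k) x * v k i))"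
    by (simp add: shifted_gram_def)
  show ?thesis
    unfolding e ip_add_right ip_scale_right ip_sum_right by (simp add: ip_commute[of m y])
qed

lemma ip_downdate: "ip m y (downdate m u s T x) = ip m y (T x) - s * ip m u x * ip m u y"
proof -
  have "downdate m u s T x = (\<lambda>i. T x i + (- s * ip m u x) * u i)"
    by (simp add: downdate_def)
  then show ?thesis by (simp only: ip_add_right ip_scale_right) (simp add: ip_commute)
qed

lemma downdate_shifted_gram_linear:
  "downdate m u s (shifted_gram m K I v) (\<lambda>i. x i + y i)
    = (\<lambda>i. downdate m u s (shifted_gram m K I v) x i + downdate m u s (shifted_gram m K I v) y i)"
  "downdate m u s (shifted_gram m K I v) (\<lambda>i. c * x i)
    = (\<lambda>i. c * downdate m u s (shifted_gram m K I v) x i)"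
  by (rule ext, simp add: downdate_def shifted_gram_add shifted_gram_scale ip_add_right ip_scale_right
      algebra_simps)+

lemma shifted_gram_insert:
  assumes "finite I" "j \<notin> I"
  shows "shifted_gram m K (insert j I) v = downdate m (v j) 1 (shifted_gram m K I v)"
  using assms by (intro ext) (simp add: shifted_gram_def downdate_def)

lemma shifted_gram_form_le: "ip m x (shifted_gram m K I v x) \<le> K * ip m x x"
  by (simp add: ip_shifted_gram sum_nonneg)

lemma ip_sq_le_bound:
  assumes "ip m u u \<le> R"
  shows "(ip m u x)\<^sup>2 \<le> R * ip m x x"
  using ip_Cauchy_Schwarz[of m u x] mult_right_mono[OF assms ip_self_nonneg[of m x]] by linarith

text \<open>Each rank-one term is at most R. The bound ignores all cancellation, which is harmless
  because K tends to infinity with the number of vectors fixed.\<close>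

lemma shifted_gram_form_ge:
  assumes "\<And>k. k \<in> I \<Longrightarrow> ip m (v k) (v k) \<le> R"
  shows "(K - real (card I) * R) * ip m x x \<le> ip m x (shifted_gram m K I v x)"
proof -
  have "(\<Sum>k\<in>I. ip m (v k) x * ip m (v k) x) \<le> (\<Sum>k\<in>I. R * ip m x x)"
    by (intro sum_mono) (use ip_sq_le_bound[OF assms] in \<open>simp add: power2_eq_square\<close>)
  then show ?thesis by (simp add: ip_shifted_gram algebra_simps)
qed

lemma shifted_gram_psd:
  assumes "\<And>k. k \<in> I \<Longrightarrow> ip m (v k) (v k) \<le> R" "real (card I) * R \<le> K"
  shows "psd_operator m (shifted_gram m K I v)"
proof
  show "ip m x (shifted_gram m K I v y) = ip m (shifted_gram m K I v x) y" for x y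
    by (simp add: ip_shifted_gram ip_commute[of m "shifted_gram m K I v x"] ip_commute[of m x y] mult.commute)
  show "0 \<le> ip m x (shifted_gram m K I v x)" for x
    by (rule order_trans[OF mult_nonneg_nonneg shifted_gram_form_ge[OF assms(1)]])
      (use assms(2) ip_self_nonneg in auto)
qed (simp_all add: shifted_gram_add shifted_gram_scale)

lemma DERIV_shifted_gram:
  assumes "\<And>i. ((\<lambda>s. z s i) has_real_derivative z' i) (at s)"
  shows "((\<lambda>s. shifted_gram m K I v (z s) i) has_real_derivative shifted_gram m K I v z' i) (at s)"
  unfolding shifted_gram_def ip_def
  by (auto intro!: derivative_eq_intros assms sum.cong simp: mult.commute)

lemma DERIV_ip_const:
  assumes "\<And>i. ((\<lambda>s. z s i) has_real_derivative z' i) (at s)"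
  shows "((\<lambda>s. ip m u (z s)) has_real_derivative ip m u z') (at s)"
  unfolding ip_def
  by (auto intro!: derivative_eq_intros assms sum.cong simp: mult.commute)

text \<open>The product rule for noncommuting factors: the derivative of D^p is the sum of D^j D'
  D^(p-1-j), with D' = - u u^T.\<close>

lemma DERIV_downdate_funpow:
  fixes m K I v u
  defines "D \<equiv> \<lambda>s. downdate m u s (shifted_gram m K I v)"
  shows "((\<lambda>s. (D s ^^ p) y i) has_real_derivative
      (\<Sum>j<p. - ip m u ((D s ^^ (p - 1 - j)) y) * (D s ^^ j) u i)) (at s)"
proof (induction p arbitrary: i)
  case (Suc p)
  define z where "z = (\<lambda>s. (D s ^^ p) y)"
  define z' where "z' = (\<lambda>i. \<Sum>j<p. - ip m u ((D s ^^ (p - 1 - j)) y) * (D s ^^ j) u i)"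
  have dz: "((\<lambda>s. z s i) has_real_derivative z' i) (at s)" for i
    using Suc.IH unfolding z_def z'_def .
  have Dsum: "D s (\<lambda>i. \<Sum>j<q. c j * x j i) i = (\<Sum>j<q. c j * D s (x j) i)" for q :: nat and c x
  proof (induction q arbitrary: i)
    case 0
    show ?case using downdate_shifted_gram_linear(2)[of m u s K I v 0 "\<lambda>_. 0"]
      by (simp add: D_def)
  next
    case (Suc q)
    show ?case by (simp add: D_def downdate_shifted_gram_linear) (use Suc in \<open>simp add: D_def\<close>)
  qed
  have "((\<lambda>s. D s (z s) i) has_real_derivative D s z' i - ip m u (z s) * u i) (at s)"
    unfolding D_def downdate_def
    by (rule derivative_eq_intros DERIV_shifted_gram DERIV_ip_const dz refl)+
      (simp add: algebra_simps)
  also have "D s z' i - ip m u (z s) * u i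
    = (\<Sum>j<p. - ip m u ((D s ^^ (p - 1 - j)) y) * (D s ^^ Suc j) u i) - ip m u (z s) * u i"
    unfolding z'_def Dsum by simp
  also have "\<dots> = (\<Sum>j<Suc p. - ip m u ((D s ^^ (Suc p - 1 - j)) y) * (D s ^^ j) u i)"
    by (subst sum.lessThan_Suc_shift) (simp add: z_def)
  finally show ?case unfolding z_def by simp
qed simp

text \<open>The trace of a power decreases at the rate \<open>p k(s)\<close> with \<open>k(s) = \<langle>u, D\<^sub>s\<^sup>p\<^sup>-\<^sup>1 u\<rangle>\<close>, and log-convexity
  of the moments gives \<open>k' \<ge> - L k\<close>; this replaces the Golden--Thompson inequality.\<close>
lemma trace_pow_downdate_le:
  fixes m K I v u and q :: nat
  defines "T \<equiv> shifted_gram m K I v"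
  assumes low: "\<And>x. (b + R) * ip m x x \<le> ip m x (T x)"
    and u: "ip m u u \<le> R" and b: "0 < b" and L: "L = real q * R / b" "0 < L"
  shows "trace_pow m (downdate m u 1 T) (Suc q)
    \<le> trace_pow m T (Suc q) - real (Suc q) * ((1 - exp (- L)) / L) * ip m u ((T ^^ q) u)"
proof -
  define D where "D = (\<lambda>s. downdate m u s T)"
  have R: "0 \<le> R" using u ip_self_nonneg[of m u] by linarith
  \<comment> \<open>The reserve R in \<open>low\<close> pays for s u u^T, whose form is at most R,
    so b is a lower bound uniformly along the path.\<close>
  have Dlow: "b * ip m x x \<le> ip m x (D s x)" if "0 \<le> s" "s \<le> 1" for s x
  proof -
    have "s * (ip m u x)\<^sup>2 \<le> 1 * (R * ip m x x)"
      using that by (intro mult_mono ip_sq_le_bound u) auto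
    then show ?thesis using low[of x]
      by (simp add: D_def ip_downdate power2_eq_square algebra_simps)
  qed
  have psd: "psd_operator m (D s)" if s: "0 \<le> s" "s \<le> 1" for s
  proof
    show "ip m x (D s y) = ip m (D s x) y" for x y
      by (simp add: D_def T_def ip_downdate ip_shifted_gram ip_commute[of m "downdate m u s T x" for T x]
        ip_commute[of m x y] mult_ac)
    show "0 \<le> ip m x (D s x)" for x
      by (rule order_trans[OF mult_nonneg_nonneg Dlow[OF s]]) (use b ip_self_nonneg in auto)
  qed (simp_all add: D_def T_def downdate_shifted_gram_linear)
  define k where "k = (\<lambda>s. ip m u ((D s ^^ q) u))"
  define k' where "k' = (\<lambda>s. - (\<Sum>j<q. ip m u ((D s ^^ (q - 1 - j)) u) * ip m u ((D s ^^ j) u)))"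
  define g where "g = (\<lambda>s. trace_pow m (D s) (Suc q))"
  have dk: "(k has_real_derivative k' s) (at s)" for s
  proof -
    have "(k has_real_derivative
       ip m u (\<lambda>i. \<Sum>j<q. - ip m u ((D s ^^ (q - 1 - j)) u) * (D s ^^ j) u i)) (at s)"
      unfolding k_def
      by (rule DERIV_ip_const) (use DERIV_downdate_funpow in \<open>simp add: D_def T_def\<close>)
    then show ?thesis unfolding ip_sum_right ip_scale_right k'_def by (simp add: sum_negf)
  qed
  have dg: "(g has_real_derivative - (real (Suc q) * k s)) (at s)" if s: "0 \<le> s" "s \<le> 1" for s
  proof -
    interpret psd_operator m "D s" by (rule psd[OF s])
    have "(g has_real_derivative
       (\<Sum>i<m. ip m (unit_vec_at i) (\<lambda>l. \<Sum>j<Suc q. - ip m u ((D s ^^ (Suc q - 1 - j)) (unit_vec_at i)) * (D s ^^ j) u l))) (at s)"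
      unfolding g_def trace_pow_def
      by (intro DERIV_sum DERIV_ip_const) (use DERIV_downdate_funpow[where p = "Suc q"] in \<open>simp add: D_def T_def\<close>)
    \<comment> \<open>Cyclicity of the trace: every summand of the product rule becomes <D^(q-j) u,
      D^j u> = k(s), independently of j, whence the factor q + 1.\<close>
    also have "(\<Sum>i<m. ip m (unit_vec_at i) (\<lambda>l. \<Sum>j<Suc q. - ip m u ((D s ^^ (Suc q - 1 - j)) (unit_vec_at i)) * (D s ^^ j) u l))
       = (\<Sum>i<m. \<Sum>j<Suc q. - ((D s ^^ (Suc q - 1 - j)) u i) * (D s ^^ j) u i)"
      unfolding funpow_sym
      by (rule sum.cong) (simp_all add: ip_unit_vec_at ip_commute[of m _ "unit_vec_at _"] del: sum.lessThan_Suc)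
    also have "\<dots> = - (\<Sum>j<Suc q. ip m ((D s ^^ (q - j)) u) ((D s ^^ j) u))"
      by (subst sum.swap) (simp add: ip_def sum_negf del: sum.lessThan_Suc)
    also have "\<dots> = - (real (Suc q) * k s)"
      by (simp add: ip_funpow_split k_def del: sum.lessThan_Suc)
    finally show ?thesis .
  qed
  have k'_ge: "- L * k s \<le> k' s" if s: "0 \<le> s" "s \<le> 1" for s
  proof -
    interpret psd_operator m "D s" by (rule psd[OF s])
    \<comment> \<open>Supermultiplicativity merges the two moments into one of order q - 1, and the
      lower bound b raises it to order q. The q summands together give L = q R / b.\<close>
    have "ip m u ((D s ^^ (q - 1 - j)) u) * ip m u ((D s ^^ j) u) \<le> R / b * k s" if j: "j < q" for j
    proof -
      have "ip m u ((D s ^^ (q - 1 - j)) u) * ip m u ((D s ^^ j) u) \<le> ip m u u * ip m u ((D s ^^ (q - 1)) u)"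
        using moment_supermult[of u "q - 1 - j" j] j by simp
      also have "\<dots> \<le> R * ip m u ((D s ^^ (q - 1)) u)"
        by (rule mult_right_mono[OF u moment_nonneg])
      also have "\<dots> \<le> R * (k s / b)"
        using moment_Suc_ge[OF Dlow[OF s], of u "q - 1"] j b R
        by (intro mult_left_mono) (simp_all add: k_def field_simps)
      finally show ?thesis by simp
    qed
    then have "(\<Sum>j<q. ip m u ((D s ^^ (q - 1 - j)) u) * ip m u ((D s ^^ j) u)) \<le> (\<Sum>j<q. R / b * k s)"
      by (intro sum_mono) simp
    then show ?thesis by (simp add: k'_def L)
  qed
  \<comment> \<open>Gronwall's argument: exp(L s) k(s) is nondecreasing.\<close>
  have k_ge: "exp (- L * s) * k 0 \<le> k s" if s: "0 \<le> s" "s \<le> 1" for s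
  proof -
    have "exp (L * 0) * k 0 \<le> exp (L * s) * k s"
    proof (rule DERIV_nonneg_imp_nondecreasing[OF s(1)])
      fix t assume t: "0 \<le> t" "t \<le> s"
      show "\<exists>y. ((\<lambda>s. exp (L * s) * k s) has_real_derivative y) (at t) \<and> 0 \<le> y"
      proof (intro exI conjI)
        show "((\<lambda>s. exp (L * s) * k s) has_real_derivative exp (L * t) * (L * k t + k' t)) (at t)"
          by (rule derivative_eq_intros dk refl)+ (simp add: algebra_simps)
        show "0 \<le> exp (L * t) * (L * k t + k' t)"
          using k'_ge[of t] t s by simp
      qed
    qed
    then show ?thesis by (simp add: exp_minus field_simps)
  qed
  \<comment> \<open>The subtracted term is an antiderivative of the lower bound for -g', up to sign;
    its values at the endpoints produce (1 - exp(-L)) / L.\<close>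
  have "g 1 - real (Suc q) * k 0 * exp (- L * 1) / L \<le> g 0 - real (Suc q) * k 0 * exp (- L * 0) / L"
  proof (rule DERIV_nonpos_imp_nonincreasing[of 0 1])
    fix t :: real assume t: "0 \<le> t" "t \<le> 1"
    show "\<exists>y. ((\<lambda>s. g s - real (Suc q) * k 0 * exp (- L * s) / L) has_real_derivative y) (at t) \<and> y \<le> 0"
    proof (intro exI conjI)
      show "((\<lambda>s. g s - real (Suc q) * k 0 * exp (- L * s) / L) has_real_derivative
         - (real (Suc q) * k t) + real (Suc q) * (exp (- L * t) * k 0)) (at t)"
      proof -
        have "((\<lambda>s. real (Suc q) * k 0 * exp (- L * s) / L) has_real_derivative
          real (Suc q) * k 0 * (exp (- L * t) * (- L)) / L) (at t)"
          using L(2) by (auto intro!: derivative_eq_intros)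
        from DERIV_diff[OF dg[OF t] this] show ?thesis
          using L(2) by (simp add: mult_ac)
      qed
      show "- (real (Suc q) * k t) + real (Suc q) * (exp (- L * t) * k 0) \<le> 0"
        using mult_left_mono[OF k_ge[OF t], of "real (Suc q)"] by simp
    qed
  qed simp
  then have "g 1 \<le> g 0 - real (Suc q) * ((1 - exp (- L)) / L) * k 0"
    by (simp add: diff_divide_distrib right_diff_distrib left_diff_distrib mult_ac)
  moreover have "D 0 = T" by (simp add: D_def downdate_def fun_eq_iff)
  ultimately show ?thesis by (simp add: g_def k_def) (simp add: D_def)
qed

section \<open>A Chernoff bound for the smallest eigenvalue\<close>

text \<open>Some vector witnesses that the smallest eigenvalue of \<open>\<Sum> v\<^sub>k v\<^sub>k\<^sup>T\<close> is less than \<open>t\<close>; restricting to rational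
  vectors changes nothing and makes the event measurable.\<close>
definition small_form :: "nat \<Rightarrow> 'k set \<Rightarrow> ('k \<Rightarrow> nat \<Rightarrow> real) \<Rightarrow> real \<Rightarrow> bool" where
  "small_form m I v t \<longleftrightarrow>
     (\<exists>c\<in>{..<m} \<rightarrow>\<^sub>E \<rat>. (\<Sum>k\<in>I. (ip m (v k) c)\<^sup>2) < t * ip m c c)"

text \<open>The negation of the strict inequality is a closed condition, so it passes from the grid
  points c_j, with coordinates rounded down to multiples of 1/(j+1), to their limit x.\<close>

lemma not_small_form_ge:
  assumes "\<not> small_form m I v t"
  shows "t * ip m x x \<le> (\<Sum>k\<in>I. (ip m (v k) x)\<^sup>2)"
proof -
  define c where "c = (\<lambda>j::nat. \<lambda>i\<in>{..<m}. of_int \<lfloor>x i * real (Suc j)\<rfloor> / real (Suc j))"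
  have cQ: "c j \<in> {..<m} \<rightarrow>\<^sub>E \<rat>" for j
    by (auto simp: c_def)
  have lim: "(\<lambda>j. c j i) \<longlonglongrightarrow> x i" if "i < m" for i
  proof -
    have "(\<lambda>j. of_int \<lfloor>x i * real (Suc j)\<rfloor> / real (Suc j)) \<longlonglongrightarrow> x i"
    proof (rule tendsto_sandwich)
      show "(\<lambda>j. x i - 1 / real (Suc j)) \<longlonglongrightarrow> x i"
        using tendsto_diff[OF tendsto_const LIMSEQ_Suc[OF lim_1_over_n], of "x i"] by simp
      show "\<forall>\<^sub>F j in sequentially. x i - 1 / real (Suc j) \<le> of_int \<lfloor>x i * real (Suc j)\<rfloor> / real (Suc j)"
      proof (intro always_eventually allI)
        fix j
        have "(x i * real (Suc j) - 1) / real (Suc j) \<le> of_int \<lfloor>x i * real (Suc j)\<rfloor> / real (Suc j)"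
          by (intro divide_right_mono) linarith+
        then show "x i - 1 / real (Suc j) \<le> of_int \<lfloor>x i * real (Suc j)\<rfloor> / real (Suc j)"
          by (simp add: diff_divide_distrib del: of_nat_Suc)
      qed
      show "\<forall>\<^sub>F j in sequentially. of_int \<lfloor>x i * real (Suc j)\<rfloor> / real (Suc j) \<le> x i"
      proof (intro always_eventually allI)
        fix j
        have "of_int \<lfloor>x i * real (Suc j)\<rfloor> \<le> x i * real (Suc j)" by linarith
        then show "of_int \<lfloor>x i * real (Suc j)\<rfloor> / real (Suc j) \<le> x i"
          by (simp add: field_simps)
      qed
    qed simp
    then show ?thesis using that by (simp add: c_def)
  qed
  have "(\<lambda>j. t * ip m (c j) (c j)) \<longlonglongrightarrow> t * ip m x x"
    "(\<lambda>j. \<Sum>k\<in>I. (ip m (v k) (c j))\<^sup>2) \<longlonglongrightarrow> (\<Sum>k\<in>I. (ip m (v k) x)\<^sup>2)"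
    unfolding ip_def by (auto intro!: tendsto_intros lim)
  then show ?thesis
    by (rule LIMSEQ_le) (use assms cQ in \<open>auto simp: small_form_def not_less\<close>)
qed

text \<open>Dropping vectors shrinks the quadratic form, so the same witness works. This is what
  allows the rows chosen by the determinantal part to be discarded.\<close>

lemma small_form_mono:
  assumes "finite J" "I \<subseteq> J" "s \<le> t" "small_form m J v s"
  shows "small_form m I v t"
proof -
  obtain c where c: "c \<in> {..<m} \<rightarrow>\<^sub>E \<rat>" "(\<Sum>k\<in>J. (ip m (v k) c)\<^sup>2) < s * ip m c c"
    using assms unfolding small_form_def by auto
  have "(\<Sum>k\<in>I. (ip m (v k) c)\<^sup>2) \<le> (\<Sum>k\<in>J. (ip m (v k) c)\<^sup>2)"
    using assms by (intro sum_mono2) auto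
  moreover have "s * ip m c c \<le> t * ip m c c"
    using assms ip_self_nonneg by (intro mult_right_mono) auto
  ultimately have "(\<Sum>k\<in>I. (ip m (v k) c)\<^sup>2) < t * ip m c c" using c(2) by linarith
  then show ?thesis using c(1) unfolding small_form_def by blast
qed

section \<open>Bounded isotropic random vectors\<close>

locale isotropic_vectors = prob_space \<nu> for \<nu> :: "'a measure" +
  fixes m :: nat and R :: real and v :: "'a \<Rightarrow> nat \<Rightarrow> real"
  assumes R_pos: "0 < R"
    and v_measurable: "i < m \<Longrightarrow> (\<lambda>x. v x i) \<in> borel_measurable \<nu>"
    and v_orthonormal: "\<lbrakk>i < m; j < m\<rbrakk> \<Longrightarrow> (\<integral>x. v x i * v x j \<partial>\<nu>) = (if i = j then 1 else 0)"
    and v_bound: "ip m (v x) (v x) \<le> R"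
begin

lemma product_measurable:
  "k \<in> I \<Longrightarrow> i < m \<Longrightarrow> (\<lambda>xs. v (xs k) i) \<in> borel_measurable (PiM I (\<lambda>_. \<nu>))"
  by (rule measurable_compose[of "\<lambda>xs. xs k" _ \<nu> "\<lambda>x. v x i"]) (auto intro: v_measurable)

lemma integrable_v_v: "i < m \<Longrightarrow> j < m \<Longrightarrow> integrable \<nu> (\<lambda>x. v x i * v x j)"
proof (rule integrable_const_bound[of _ R])
  assume ij: "i < m" "j < m"
  have sq: "(v x l)\<^sup>2 \<le> R" if "l < m" for x l
    using member_le_sum[of l "{..<m}" "\<lambda>i. v x i * v x i"] that v_bound[of x]
    by (simp add: ip_def power2_eq_square)
  have "\<bar>v x i * v x j\<bar> \<le> R" for x
    using sq[OF ij(1), of x] sq[OF ij(2), of x] sum_squares_bound[of "\<bar>v x i\<bar>" "\<bar>v x j\<bar>"]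
    by (simp add: abs_mult)
  then show "AE x in \<nu>. norm (v x i * v x j) \<le> R" by simp
qed (intro borel_measurable_times v_measurable)

lemma small_form_measurable [measurable]:
  assumes "finite I" "I \<subseteq> J"
  shows "Measurable.pred (PiM J (\<lambda>_. \<nu>)) (\<lambda>xs. small_form m I (\<lambda>k. v (xs k)) t)"
proof -
  \<comment> \<open>The witnesses are extensional because functions on all indices that are rational
    only on \<open>{..<m}\<close> would form an uncountable set.\<close>
  have count: "countable ({..<m} \<rightarrow>\<^sub>E (\<rat>::real set))"
    by (intro countable_PiE countable_rat) simp
  have [measurable]: "(\<lambda>xs. ip m (v (xs k)) c) \<in> borel_measurable (PiM J (\<lambda>_. \<nu>))"
    if "k \<in> I" for k c
    unfolding ip_def using that assms
    by (intro borel_measurable_sum borel_measurable_times borel_measurable_const product_measurable) auto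
  show ?thesis
    unfolding small_form_def pred_def by (rule sets.sets_Collect_countable_Ex'[OF _ count]) measurable
qed

text \<open>Isotropy says that v v^T has mean I; by linearity the mean of <v, T^q v> is the trace of
  T^q.\<close>

lemma integral_moment:
  assumes "psd_operator m T"
  shows "integrable \<nu> (\<lambda>x. ip m (v x) ((T ^^ q) (v x)))"
    and "(\<integral>x. ip m (v x) ((T ^^ q) (v x)) \<partial>\<nu>) = trace_pow m T q"
proof -
  interpret psd_operator m T by fact
  have e: "ip m u ((T ^^ q) u) = (\<Sum>i<m. \<Sum>j<m. (T ^^ q) (unit_vec_at i) j * (u i * u j))" for u
  proof -
    have "(T ^^ q) u i = (\<Sum>j<m. (T ^^ q) (unit_vec_at i) j * u j)" if "i < m" for i
      using ip_unit_vec_at[OF that, of "(T ^^ q) u"] funpow_sym[of "unit_vec_at i" q u]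
      by (simp add: ip_def)
    then show ?thesis by (simp add: ip_def[of m u] sum_distrib_left mult_ac)
  qed
  show "integrable \<nu> (\<lambda>x. ip m (v x) ((T ^^ q) (v x)))"
    unfolding e by (intro Bochner_Integration.integrable_sum integrable_mult_right integrable_v_v) auto
  have "(\<integral>x. ip m (v x) ((T ^^ q) (v x)) \<partial>\<nu>)
     = (\<Sum>i<m. \<Sum>j<m. (T ^^ q) (unit_vec_at i) j * (\<integral>x. v x i * v x j \<partial>\<nu>))"
    unfolding e by (subst Bochner_Integration.integral_sum
       Bochner_Integration.integral_sum[OF integrable_mult_right[OF integrable_v_v]] |
       auto intro!: Bochner_Integration.integrable_sum integrable_v_v sum.cong)+
  also have "\<dots> = (\<Sum>i<m. \<Sum>j<m. (T ^^ q) (unit_vec_at i) j * (if i = j then 1 else 0))"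
    by (intro sum.cong refl) (simp add: v_orthonormal)
  also have "\<dots> = trace_pow m T q"
    by (simp add: trace_pow_def ip_unit_vec_at if_distrib cong: if_cong)
  finally show "(\<integral>x. ip m (v x) ((T ^^ q) (v x)) \<partial>\<nu>) = trace_pow m T q" .
qed

lemma trace_pow_measurable [measurable]:
  assumes "I \<subseteq> J"
  shows "(\<lambda>xs. trace_pow m (shifted_gram m K I (\<lambda>k. v (xs k))) p) \<in> borel_measurable (PiM J (\<lambda>_. \<nu>))"
proof -
  have *: "(\<lambda>xs. (shifted_gram m K I (\<lambda>k. v (xs k)) ^^ p) y i) \<in> borel_measurable (PiM J (\<lambda>_. \<nu>))"
    if "i < m" for y i
    using that
  proof (induction p arbitrary: i)
    case (Suc p)
    show ?case
      unfolding funpow.simps o_apply shifted_gram_def[of m K I _ "(_ ^^ _) _"] ip_def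
      using assms
      by (intro borel_measurable_diff borel_measurable_sum borel_measurable_times borel_measurable_const
          product_measurable Suc) auto
  qed simp
  show ?thesis
    unfolding trace_pow_def ip_def
    by (intro borel_measurable_sum borel_measurable_times borel_measurable_const *) auto
qed

lemma trace_pow_empty: "trace_pow m (shifted_gram m K {} w) p = real m * K ^ p"
proof -
  have "(shifted_gram m K {} w ^^ p) x = (\<lambda>i. K ^ p * x i)" for x
    by (induction p) (simp_all add: shifted_gram_def mult_ac)
  then show ?thesis
    by (simp add: trace_pow_def ip_scale_right ip_unit_vec_at) (simp add: unit_vec_at_def)
qed

text \<open>With the earlier points fixed, averaging \<open>trace_pow_downdate_le\<close> over the
  new one replaces <v, T^q v> by the trace of T^q, which is at least the trace of T^(q+1) divided by
  K because T \<le> K. The trace thus shrinks by a factor 1 - c \<le> exp(-c).\<close>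

lemma nn_integral_trace_pow_step:
  fixes I :: "'k set" and xs :: "'k \<Rightarrow> 'a" and K :: real
  defines "T \<equiv> shifted_gram m K I (\<lambda>k. v (xs k))"
  assumes b: "0 < b" and q: "0 < q" and K: "real (card I) * R + R + b \<le> K"
    and L: "L = real q * R / b" and c: "c = real (Suc q) * ((1 - exp (- L)) / L) / K"
  shows "(\<integral>\<^sup>+y. ennreal (trace_pow m (downdate m (v y) 1 T) (Suc q)) \<partial>\<nu>)
     \<le> ennreal (exp (- c)) * ennreal (trace_pow m T (Suc q))"
proof -
  define C where "C = real (Suc q) * ((1 - exp (- L)) / L)"
  have cC: "c = C / K" by (simp add: c C_def)
  have L0: "0 < L" using L b q R_pos by simp
  have C0: "0 \<le> C" using L0 by (simp add: C_def)
  have K0: "0 < K" using K b R_pos mult_nonneg_nonneg[of "real (card I)" R] by linarith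
  have psdT: "psd_operator m T"
    unfolding T_def by (rule shifted_gram_psd[where R = R]) (use v_bound K b R_pos in auto)
  then interpret psd_operator m T .
  have low: "(b + R) * ip m x x \<le> ip m x (T x)" for x
  proof -
    have "(b + R) * ip m x x \<le> (K - real (card I) * R) * ip m x x"
      by (rule mult_right_mono[OF _ ip_self_nonneg]) (use K in simp)
    also have "\<dots> \<le> ip m x (T x)" unfolding T_def by (rule shifted_gram_form_ge) (rule v_bound)
    finally show ?thesis .
  qed
  have step: "trace_pow m (downdate m (v y) 1 T) (Suc q)
      \<le> trace_pow m T (Suc q) - C * ip m (v y) ((T ^^ q) (v y))" for y
    unfolding C_def T_def
    by (rule trace_pow_downdate_le[OF low[unfolded T_def] v_bound b L L0])
  \<comment> \<open>Together with \<open>step\<close> this makes the upper bound nonnegative, so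
    that its nonnegative integral is its ordinary integral.\<close>
  have nn: "0 \<le> trace_pow m (downdate m (v y) 1 T) (Suc q)" for y
  proof -
    have "psd_operator m (downdate m (v y) 1 T)"
    proof
      show "ip m x (downdate m (v y) 1 T z) = ip m (downdate m (v y) 1 T x) z" for x z
        using sym[of z x]
        by (simp add: ip_downdate ip_commute[of m "downdate m u 1 T x" for u T x] ip_commute[of m x "T z"]
            mult_ac)
      show "0 \<le> ip m x (downdate m (v y) 1 T x)" for x
      proof -
        have "0 \<le> b * ip m x x" using b ip_self_nonneg by simp
        then show ?thesis
          using low[of x] ip_sq_le_bound[OF v_bound[of y], of x]
          by (simp add: ip_downdate power2_eq_square ring_distribs)
      qed
    qed (unfold T_def, (rule downdate_shifted_gram_linear)+)
    then show ?thesis by (rule psd_operator.trace_pow_nonneg)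
  qed
  have "(\<integral>\<^sup>+y. ennreal (trace_pow m (downdate m (v y) 1 T) (Suc q)) \<partial>\<nu>)
     \<le> (\<integral>\<^sup>+y. ennreal (trace_pow m T (Suc q) - C * ip m (v y) ((T ^^ q) (v y))) \<partial>\<nu>)"
    by (intro nn_integral_mono ennreal_leI step)
  also have "\<dots> = ennreal (\<integral>y. trace_pow m T (Suc q) - C * ip m (v y) ((T ^^ q) (v y)) \<partial>\<nu>)"
  proof (rule nn_integral_eq_integral)
    show "integrable \<nu> (\<lambda>y. trace_pow m T (Suc q) - C * ip m (v y) ((T ^^ q) (v y)))"
      by (intro Bochner_Integration.integrable_diff integrable_const integrable_mult_right
          integral_moment(1)[OF psdT])
  qed (use order_trans[OF nn step] in simp)
  also have "(\<integral>y. trace_pow m T (Suc q) - C * ip m (v y) ((T ^^ q) (v y)) \<partial>\<nu>)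
     = trace_pow m T (Suc q) - C * trace_pow m T q"
    by (simp add: integral_moment[OF psdT] prob_space)
  also have "ennreal (trace_pow m T (Suc q) - C * trace_pow m T q) \<le> ennreal (exp (- c) * trace_pow m T (Suc q))"
  proof (rule ennreal_leI)
    have "trace_pow m T (Suc q) \<le> K * trace_pow m T q"
      by (rule trace_pow_Suc_le) (use K0 in \<open>auto simp: T_def intro: shifted_gram_form_le\<close>)
    then have "C * (trace_pow m T (Suc q) / K) \<le> C * trace_pow m T q"
      using K0 C0 by (intro mult_left_mono) (simp_all add: field_simps)
    then have "trace_pow m T (Suc q) - C * trace_pow m T q \<le> (1 + - c) * trace_pow m T (Suc q)"
      using cC by (simp add: algebra_simps)
    also have "\<dots> \<le> exp (- c) * trace_pow m T (Suc q)"
      by (intro mult_right_mono trace_pow_nonneg exp_ge_add_one_self)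
    finally show "trace_pow m T (Suc q) - C * trace_pow m T q \<le> exp (- c) * trace_pow m T (Suc q)" .
  qed
  finally show ?thesis using trace_pow_nonneg[of "Suc q"] by (simp add: ennreal_mult)
qed

text \<open>Fubini peels off one point at a time, each costing a factor exp(-c). The condition on K
  for the full set implies it for smaller ones, so K, L and c stay the same throughout the
  induction.\<close>

lemma nn_integral_trace_pow_le:
  assumes "finite I"
    and b: "0 < b" and q: "0 < q" and K: "real (card I) * R + b \<le> K"
    and L: "L = real q * R / b" and c: "c = real (Suc q) * ((1 - exp (- L)) / L) / K"
  shows "(\<integral>\<^sup>+xs. ennreal (trace_pow m (shifted_gram m K I (\<lambda>k. v (xs k))) (Suc q)) \<partial>PiM I (\<lambda>_. \<nu>))
    \<le> ennreal (real m * K ^ Suc q * exp (- (c * real (card I))))"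
  using assms(1) K
proof (induction I)
  case empty
  interpret product_prob_space "\<lambda>_. \<nu>" "{}" by standard
  show ?case by (simp add: trace_pow_empty emeasure_space_1)
next
  case (insert j I)
  interpret P: product_prob_space "\<lambda>_. \<nu>" "insert j I" by standard
  have K0: "0 \<le> K" using insert.prems b R_pos mult_nonneg_nonneg[of "real (card (insert j I))" R] by linarith
  have Kj: "real (card I) * R + R + b \<le> K" using insert.prems insert.hyps by (simp add: algebra_simps)
  have "(\<integral>\<^sup>+xs. ennreal (trace_pow m (shifted_gram m K (insert j I) (\<lambda>k. v (xs k))) (Suc q))
      \<partial>PiM (insert j I) (\<lambda>_. \<nu>))
    = (\<integral>\<^sup>+xs. (\<integral>\<^sup>+y. ennreal (trace_pow m (shifted_gram m K (insert j I) (\<lambda>k. v ((xs(j := y)) k))) (Suc q)) \<partial>\<nu>)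
      \<partial>PiM I (\<lambda>_. \<nu>))"
    by (rule P.product_nn_integral_insert[OF insert.hyps]) measurable
  also have "\<dots> = (\<integral>\<^sup>+xs. (\<integral>\<^sup>+y. ennreal (trace_pow m
        (downdate m (v y) 1 (shifted_gram m K I (\<lambda>k. v (xs k)))) (Suc q)) \<partial>\<nu>) \<partial>PiM I (\<lambda>_. \<nu>))"
  proof -
    have "shifted_gram m K (insert j I) (\<lambda>k. v ((xs(j := y)) k))
        = downdate m (v y) 1 (shifted_gram m K I (\<lambda>k. v (xs k)))" for xs y
    proof -
      have "shifted_gram m K I (\<lambda>k. v ((xs(j := y)) k)) = shifted_gram m K I (\<lambda>k. v (xs k))"
        using insert.hyps unfolding shifted_gram_def by (intro ext arg_cong2[of _ _ _ _ "(-)"] sum.cong) auto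
      then show ?thesis by (simp only: shifted_gram_insert[OF insert.hyps]) simp
    qed
    then show ?thesis by simp
  qed
  also have "\<dots> \<le> (\<integral>\<^sup>+xs. ennreal (exp (- c)) * ennreal (trace_pow m (shifted_gram m K I (\<lambda>k. v (xs k))) (Suc q))
       \<partial>PiM I (\<lambda>_. \<nu>))"
    by (intro nn_integral_mono nn_integral_trace_pow_step[OF b q Kj L c])
  also have "\<dots> = ennreal (exp (- c)) * (\<integral>\<^sup>+xs. ennreal (trace_pow m (shifted_gram m K I (\<lambda>k. v (xs k))) (Suc q))
       \<partial>PiM I (\<lambda>_. \<nu>))"
    by (rule nn_integral_cmult) measurable
  also have "\<dots> \<le> ennreal (exp (- c)) * ennreal (real m * K ^ Suc q * exp (- (c * real (card I))))"
    by (intro mult_left_mono insert.IH) (use Kj R_pos in auto)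
  also have "\<dots> = ennreal (exp (- c) * (real m * K ^ Suc q * exp (- (c * real (card I)))))"
    using K0 by (simp add: ennreal_mult)
  also have "exp (- c) * (real m * K ^ Suc q * exp (- (c * real (card I))))
     = real m * K ^ Suc q * exp (- (c * real (card (insert j I))))"
    using insert.hyps by (simp add: mult_ac ring_distribs exp_add flip: exp_add)
  finally show ?case .
qed

text \<open>Markov's inequality for the trace. A witness x of the event has Rayleigh quotient at
  least K - t for the shifted operator, so the trace is at least (K - t)^p. The exponent p = 2r + 2
  is even, as \<open>moment_even_le_trace\<close> requires.\<close>

lemma prob_small_form_le_pow:
  fixes I :: "'k set"
  assumes I: "finite I" and t: "0 \<le> t" "t < K"
    and b: "0 < b" and K: "real (card I) * R + b \<le> K"
    and L: "L = real (Suc (r + r)) * R / b"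
    and c: "c = real (Suc (Suc (r + r))) * ((1 - exp (- L)) / L) / K"
  shows "measure (PiM I (\<lambda>_. \<nu>)) {xs \<in> space (PiM I (\<lambda>_. \<nu>)). small_form m I (\<lambda>k. v (xs k)) t}
    \<le> real m * K ^ Suc (Suc (r + r)) * exp (- (c * real (card I))) / (K - t) ^ Suc (Suc (r + r))"
    (is "measure ?P ?B \<le> ?M / ?\<tau>")
proof -
  interpret P: product_prob_space "\<lambda>_. \<nu>" I by standard
  let ?tr = "\<lambda>xs. trace_pow m (shifted_gram m K I (\<lambda>k. v (xs k))) (Suc (Suc (r + r)))"
  have \<tau>: "0 < ?\<tau>" using t by simp
  have tr: "?\<tau> \<le> ?tr xs" if xs: "xs \<in> ?B" for xs
  proof -
    define T where "T = shifted_gram m K I (\<lambda>k. v (xs k))"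
    interpret psd_operator m T
      unfolding T_def by (rule shifted_gram_psd[where R = R]) (use v_bound K b in auto)
    obtain x where "(\<Sum>k\<in>I. (ip m (v (xs k)) x)\<^sup>2) < t * ip m x x"
      using xs unfolding small_form_def by blast
    then have x: "(\<Sum>k\<in>I. (ip m (v (xs k)) x)\<^sup>2) \<le> t * ip m x x" and "ip m x x \<noteq> 0"
      using sum_nonneg[of I "\<lambda>k. (ip m (v (xs k)) x)\<^sup>2"] by auto
    then have xx: "0 < ip m x x" using ip_self_nonneg[of m x] by simp
    have "(K - t) * ip m x x \<le> ip m x (T x)"
      using x by (simp add: T_def ip_shifted_gram power2_eq_square algebra_simps)
    then have "?\<tau> * ip m x x \<le> ip m x ((T ^^ Suc (Suc (r + r))) x)"
      by (rule moment_ge_power) (use t in simp)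
    also have "\<dots> \<le> ip m x x * trace_pow m T (Suc (Suc (r + r)))"
      using moment_even_le_trace[of x "Suc r"] by simp
    finally show ?thesis using xx by (simp add: T_def mult.commute)
  qed
  have [measurable]: "?tr \<in> borel_measurable ?P"
    by (rule trace_pow_measurable) simp
  have "emeasure ?P ?B \<le> emeasure ?P {xs \<in> space ?P. 1 \<le> ennreal (1 / ?\<tau>) * ennreal (?tr xs)}"
  proof (rule emeasure_mono)
    show "?B \<subseteq> {xs \<in> space ?P. 1 \<le> ennreal (1 / ?\<tau>) * ennreal (?tr xs)}"
      using tr \<tau> by (auto simp flip: ennreal_mult' intro!: ennreal_leI[of 1, simplified])
  qed measurable
  also have "\<dots> \<le> ennreal (1 / ?\<tau>) * (\<integral>\<^sup>+xs. ennreal (?tr xs) * indicator (space ?P) xs \<partial>?P)"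
    by (rule nn_integral_Markov_inequality) measurable
  also have "(\<integral>\<^sup>+xs. ennreal (?tr xs) * indicator (space ?P) xs \<partial>?P) = (\<integral>\<^sup>+xs. ennreal (?tr xs) \<partial>?P)"
    by (rule nn_integral_cong) simp
  also have "ennreal (1 / ?\<tau>) * \<dots> \<le> ennreal (1 / ?\<tau>) * ennreal ?M"
    by (intro mult_left_mono nn_integral_trace_pow_le[OF I b _ K L c]) auto
  also have "\<dots> = ennreal (?M / ?\<tau>)"
    using t \<tau> by (simp flip: ennreal_mult)
  finally show ?thesis
    using t by (simp add: P.emeasure_eq_measure)
qed

text \<open>The left side does not involve r, so r may tend to infinity. With p = 2r + 2, K =
  p/\<theta> and b = K - N R one gets L \<rightarrow> \<theta> R and c \<rightarrow> (1 -
  exp(-\<theta> R)) / R, while (K / (K - t))^p = (1 - \<theta> t / p)^(-p) tends to exp(\<theta>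
  t).\<close>

lemma prob_small_form_le:
  fixes I :: "'k set"
  assumes I: "finite I" and t: "0 \<le> t" and \<theta>: "0 < \<theta>"
  shows "measure (PiM I (\<lambda>_. \<nu>)) {xs \<in> space (PiM I (\<lambda>_. \<nu>)). small_form m I (\<lambda>k. v (xs k)) t}
    \<le> real m * exp (\<theta> * t - real (card I) * (1 - exp (- \<theta> * R)) / R)"
    (is "?p \<le> _")
proof -
  let ?N = "real (card I)"
  let ?q = "\<lambda>r. real (Suc (Suc (r + r)))"
  let ?K = "\<lambda>r. ?q r / \<theta>"
  let ?L = "\<lambda>r. real (Suc (r + r)) * R / (?K r - ?N * R)"
  let ?c = "\<lambda>r. ?q r * ((1 - exp (- ?L r)) / ?L r) / ?K r"
  let ?f = "\<lambda>r. real m * (exp (- (?c r * ?N)) / (1 + (- \<theta> * t) / ?q r) ^ Suc (Suc (r + r)))"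
  have K_inf: "filterlim ?K at_top sequentially"
    using \<theta> by real_asymp
  have ev: "\<forall>\<^sub>F r in sequentially. ?p \<le> ?f r"
    using filterlim_at_top_dense[THEN iffD1, OF K_inf, rule_format, of "max t (?N * R)"]
  proof eventually_elim
    case (elim r)
    have K0: "0 < ?K r" using \<theta> by simp
    have "?p \<le> real m * ?K r ^ Suc (Suc (r + r)) * exp (- (?c r * ?N)) / (?K r - t) ^ Suc (Suc (r + r))"
      using elim by (intro prob_small_form_le_pow[where b = "?K r - ?N * R" and L = "?L r"] I t refl) auto
    also have "\<dots> = real m * (exp (- (?c r * ?N)) / ((?K r - t) ^ Suc (Suc (r + r)) / ?K r ^ Suc (Suc (r + r))))"
      by (simp only: divide_divide_eq_right times_divide_eq_right mult_ac)
    also have "(?K r - t) ^ Suc (Suc (r + r)) / ?K r ^ Suc (Suc (r + r)) = (1 + (- \<theta> * t) / ?q r) ^ Suc (Suc (r + r))"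
    proof -
      have "(?K r - t) / ?K r = 1 + (- \<theta> * t) / ?q r" using \<theta>
        by (subst diff_divide_distrib) (simp add: mult.commute del: of_nat_Suc)
      then show ?thesis by (metis power_divide)
    qed
    finally show ?case .
  qed
  have L: "?L \<longlonglongrightarrow> \<theta> * R"
    using \<theta> R_pos by real_asymp
  have c: "?c \<longlonglongrightarrow> \<theta> * ((1 - exp (- (\<theta> * R))) / (\<theta> * R))"
  proof -
    have "(\<lambda>r. \<theta> * ((1 - exp (- ?L r)) / ?L r)) \<longlonglongrightarrow> \<theta> * ((1 - exp (- (\<theta> * R))) / (\<theta> * R))"
      using \<theta> R_pos by (intro tendsto_intros L) auto
    moreover have "a * x / (a / \<theta>) = \<theta> * x" if "a \<noteq> 0" for a x :: real
      using that \<theta> by simp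
    then have "?c = (\<lambda>r. \<theta> * ((1 - exp (- ?L r)) / ?L r))"
      by (intro ext) (simp only: of_nat_eq_0_iff nat.simps not_False_eq_True)
    ultimately show ?thesis by (simp only:)
  qed
  have "strict_mono (\<lambda>r::nat. Suc (Suc (r + r)))" by (rule strict_monoI) simp
  then have "(\<lambda>r. (1 + (- \<theta> * t) / ?q r) ^ Suc (Suc (r + r))) \<longlonglongrightarrow> exp (- \<theta> * t)"
    using LIMSEQ_subseq_LIMSEQ[OF tendsto_exp_limit_sequentially[of "- \<theta> * t"]]
    by (fastforce simp: o_def)
  then have "?f \<longlonglongrightarrow> real m * (exp (- (\<theta> * ((1 - exp (- (\<theta> * R))) / (\<theta> * R)) * ?N)) / exp (- \<theta> * t))"
    by (intro tendsto_intros c) auto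
  also have "real m * (exp (- (\<theta> * ((1 - exp (- (\<theta> * R))) / (\<theta> * R)) * ?N)) / exp (- \<theta> * t))
     = real m * exp (\<theta> * t - ?N * (1 - exp (- \<theta> * R)) / R)"
  proof -
    have "\<theta> * (x / (\<theta> * R)) = x / R" for x using \<theta> by simp
    then show ?thesis by (simp add: exp_diff exp_minus) (simp add: divide_inverse mult_ac)
  qed
  finally show ?thesis
    by (rule tendsto_lowerbound[OF _ ev]) simp
qed

end

section \<open>Gram determinants\<close>

lemma det_nat_eq_det: "det_nat k A = det (mat k k (\<lambda>(i, j). A i j))"
  by (subst det_def'[of _ k])
    (auto simp: det_nat_def lessThan_atLeast0 permutes_in_image intro!: sum.cong prod.cong)

lemma det_nat_permute_rows:
  assumes "q permutes {..<k}"
  shows "det_nat k (\<lambda>i j. A (q i) j) = of_int (sign q) * det_nat k A"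
proof -
  have q: "q permutes {0..<k}" using assms by (simp add: lessThan_atLeast0)
  have "mat k k (\<lambda>(i, j). A (q i) j) = mat k k (\<lambda>(i, j). mat k k (\<lambda>(i, j). A i j) $$ (q i, j))"
    using permutes_in_image[OF q] by (intro eq_matI) auto
  then show ?thesis
    using det_permute_rows[OF _ q, of "mat k k (\<lambda>(i, j). A i j)"] by (simp add: det_nat_eq_det)
qed

lemma det_nat_transpose: "det_nat k (\<lambda>i j. A j i) = det_nat k A"
proof -
  have "mat k k (\<lambda>(i, j). A j i) = transpose_mat (mat k k (\<lambda>(i, j). A i j))"
    by (intro eq_matI) auto
  then show ?thesis using det_transpose[of "mat k k (\<lambda>(i, j). A i j)" k] by (simp add: det_nat_eq_det)
qed

lemma det_nat_equal_rows:
  assumes "i < k" "j < k" "i \<noteq> j" "\<And>l. l < k \<Longrightarrow> A i l = A j l"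
  shows "det_nat k A = 0"
  unfolding det_nat_eq_det
  by (rule det_identical_rows[OF _ assms(3,1,2)]) (use assms in \<open>auto intro!: eq_vecI\<close>)

definition injections :: "nat \<Rightarrow> nat \<Rightarrow> (nat \<Rightarrow> nat) set" where
  "injections k n = {\<kappa> \<in> {..<k} \<rightarrow>\<^sub>E {..<n}. inj_on \<kappa> {..<k}}"

lemma card_injections:
  assumes "k \<le> n"
  shows "real (card (injections k n)) = fact n / fact (n - k)"
proof -
  have "bij_betw (\<lambda>xs. \<lambda>i\<in>{..<k}. xs ! i) {xs. length xs = k \<and> distinct xs \<and> set xs \<subseteq> {..<n}} (injections k n)"
  proof (rule bij_betw_byWitness[where f' = "\<lambda>\<kappa>. map \<kappa> [0..<k]"])
    show "\<forall>\<kappa>\<in>injections k n. (\<lambda>i\<in>{..<k}. map \<kappa> [0..<k] ! i) = \<kappa>"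
      by (auto simp: injections_def fun_eq_iff restrict_def PiE_def extensional_def)
    show "(\<lambda>xs. \<lambda>i\<in>{..<k}. xs ! i) ` {xs. length xs = k \<and> distinct xs \<and> set xs \<subseteq> {..<n}} \<subseteq> injections k n"
    proof (rule image_subsetI)
      fix xs assume "xs \<in> {xs. length xs = k \<and> distinct xs \<and> set xs \<subseteq> {..<n}}"
      then have xs: "length xs = k" "distinct xs" "set xs \<subseteq> {..<n}" by auto
      have "inj_on (\<lambda>i\<in>{..<k}. xs ! i) {..<k}"
        using xs by (intro inj_onI) (simp add: nth_eq_iff_index_eq)
      moreover have "(\<lambda>i\<in>{..<k}. xs ! i) \<in> {..<k} \<rightarrow>\<^sub>E {..<n}"
        using xs by (intro restrict_PiE[THEN iffD2]) (auto dest: nth_mem)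
      ultimately show "(\<lambda>i\<in>{..<k}. xs ! i) \<in> injections k n" by (simp add: injections_def)
    qed
    show "(\<lambda>\<kappa>. map \<kappa> [0..<k]) ` injections k n \<subseteq> {xs. length xs = k \<and> distinct xs \<and> set xs \<subseteq> {..<n}}"
    proof (rule image_subsetI)
      fix \<kappa> assume \<kappa>: "\<kappa> \<in> injections k n"
      have s: "set [0..<k] = {..<k}" by (simp add: atLeast0LessThan)
      have "\<kappa> ` {..<k} \<subseteq> {..<n}" "inj_on \<kappa> {..<k}" using \<kappa> by (auto simp: injections_def)
      then show "map \<kappa> [0..<k] \<in> {xs. length xs = k \<and> distinct xs \<and> set xs \<subseteq> {..<n}}"
        by (simp only: mem_Collect_eq length_map length_upt distinct_map distinct_upt set_map s) simp
    qed
    show "\<forall>xs\<in>{xs. length xs = k \<and> distinct xs \<and> set xs \<subseteq> {..<n}}. map (\<lambda>i\<in>{..<k}. xs ! i) [0..<k] = xs"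
      by (intro ballI nth_equalityI) auto
  qed
  then have "card (injections k n) = card {xs. length xs = k \<and> distinct xs \<and> set xs \<subseteq> {..<n}}"
    by (simp add: bij_betw_same_card)
  also have "\<dots> = \<Prod>{n - k + 1..n}"
    using card_lists_distinct_length_eq[of "{..<n}" k] assms by simp
  also have "\<dots> = fact n div fact (n - k)"
    using fact_div_fact[of "n - k" n] by simp
  finally show ?thesis
    by (simp add: real_of_nat_div fact_dvd)
qed

text \<open>The Cauchy--Binet formula, with ordered instead of increasing tuples of rows.\<close>
lemma det_nat_gram:
  "det_nat k (\<lambda>i j. \<Sum>l<n. a l i * a l j)
    = (\<Sum>\<kappa>\<in>injections k n. (det_nat k (\<lambda>i j. a (\<kappa> i) j))\<^sup>2) / fact k"
proof -
  let ?F = "{..<k} \<rightarrow>\<^sub>E {..<n}" and ?Perm = "{q. q permutes {..<k}}"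
  let ?D = "\<lambda>\<kappa>. det_nat k (\<lambda>i j. a (\<kappa> i) j)"
  have fin: "finite ?F" "finite ?Perm" by (simp_all add: finite_PiE finite_permutations)
  have "det_nat k (\<lambda>i j. \<Sum>l<n. a l i * a l j)
     = (\<Sum>p\<in>?Perm. of_int (sign p) * (\<Sum>\<kappa>\<in>?F. \<Prod>i<k. a (\<kappa> i) i * a (\<kappa> i) (p i)))"
    unfolding det_nat_def by (subst prod_sum_PiE) simp_all
  also have "\<dots> = (\<Sum>\<kappa>\<in>?F. (\<Prod>i<k. a (\<kappa> i) i) * ?D \<kappa>)"
    unfolding det_nat_def sum_distrib_left prod.distrib
    by (subst sum.swap) (simp add: mult_ac)
  finally have expand: "det_nat k (\<lambda>i j. \<Sum>l<n. a l i * a l j) = (\<Sum>\<kappa>\<in>?F. (\<Prod>i<k. a (\<kappa> i) i) * ?D \<kappa>)" .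
  \<comment> \<open>Composing all tuples with q only reorders the sum and changes the determinant by
    the sign of q. Averaging over q then completes the diagonal product to a second
    determinant.\<close>
  have reindex: "(\<Sum>\<kappa>\<in>?F. (\<Prod>i<k. a (\<kappa> i) i) * ?D \<kappa>)
      = (\<Sum>\<kappa>\<in>?F. of_int (sign q) * (\<Prod>i<k. a (\<kappa> (q i)) i) * ?D \<kappa>)" if q: "q permutes {..<k}" for q
  proof -
    have F: "\<kappa> \<circ> r \<in> ?F" if "\<kappa> \<in> ?F" "r permutes {..<k}" for \<kappa> r
      using that permutes_in_image[OF that(2)] by (auto simp: PiE_def extensional_def permutes_not_in)
    have "(\<Sum>\<kappa>\<in>?F. (\<Prod>i<k. a (\<kappa> i) i) * ?D \<kappa>) = (\<Sum>\<kappa>\<in>?F. (\<Prod>i<k. a ((\<kappa> \<circ> q) i) i) * ?D (\<kappa> \<circ> q))"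
      by (rule sum.reindex_bij_witness[of _ "\<lambda>\<kappa>. \<kappa> \<circ> q" "\<lambda>\<kappa>. \<kappa> \<circ> Hilbert_Choice.inv q"])
        (use q F permutes_inv[OF q] in \<open>auto simp: comp_assoc permutes_inv_o\<close>)
    also have "\<dots> = (\<Sum>\<kappa>\<in>?F. of_int (sign q) * (\<Prod>i<k. a (\<kappa> (q i)) i) * ?D \<kappa>)"
      using det_nat_permute_rows[OF q, of "\<lambda>i j. a (\<kappa> i) j" for \<kappa>] by (intro sum.cong) (simp_all add: mult_ac)
    finally show ?thesis .
  qed
  have "fact k * (\<Sum>\<kappa>\<in>?F. (\<Prod>i<k. a (\<kappa> i) i) * ?D \<kappa>)
     = (\<Sum>q\<in>?Perm. \<Sum>\<kappa>\<in>?F. (\<Prod>i<k. a (\<kappa> i) i) * ?D \<kappa>)"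
    by (simp add: card_permutations[of "{..<k}" k])
  also have "\<dots> = (\<Sum>q\<in>?Perm. \<Sum>\<kappa>\<in>?F. of_int (sign q) * (\<Prod>i<k. a (\<kappa> (q i)) i) * ?D \<kappa>)"
    by (intro sum.cong refl reindex) simp
  also have "\<dots> = (\<Sum>\<kappa>\<in>?F. det_nat k (\<lambda>i j. a (\<kappa> j) i) * ?D \<kappa>)"
    unfolding det_nat_def sum_distrib_right by (rule sum.swap)
  also have "\<dots> = (\<Sum>\<kappa>\<in>?F. (?D \<kappa>)\<^sup>2)"
    by (subst det_nat_transpose) (simp add: power2_eq_square)
  also have "\<dots> = (\<Sum>\<kappa>\<in>injections k n. (?D \<kappa>)\<^sup>2)"
  proof (rule sum.mono_neutral_right[OF fin(1)])
    show "\<forall>\<kappa>\<in>?F - injections k n. (?D \<kappa>)\<^sup>2 = 0"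
    proof
      fix \<kappa> assume "\<kappa> \<in> ?F - injections k n"
      then obtain i j where "i < k" "j < k" "i \<noteq> j" "\<kappa> i = \<kappa> j"
        by (auto simp: injections_def inj_on_def)
      then show "(?D \<kappa>)\<^sup>2 = 0" by (simp add: det_nat_equal_rows[of i k j])
    qed
  qed (auto simp: injections_def)
  finally show ?thesis unfolding expand by (simp add: field_simps)
qed

lemma det_nat_gram_nonneg:
  fixes n :: nat
  shows "0 \<le> det_nat k (\<lambda>i j. \<Sum>l<n. a l i * a l j)"
  unfolding det_nat_gram by (simp add: sum_nonneg)

text \<open>Increasing enumeration of the indices other than i; minors become determinants of
  reindexed matrices.\<close>

definition skip :: "nat \<Rightarrow> nat \<Rightarrow> nat" where
  "skip i j = (if j < i then j else Suc j)"

text \<open>B is the adjugate. Its diagonal cofactors carry the sign (-1)^(i+i) = 1 and are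
  therefore exactly the principal minors.\<close>

lemma det_nat_adjugate:
  fixes M :: "nat \<Rightarrow> nat \<Rightarrow> real"
  shows "\<exists>B. (\<forall>i<m. \<forall>j<m. (\<Sum>l<m. M i l * B l j) = (if i = j then det_nat m M else 0)) \<and>
    (\<forall>i<m. B i i = det_nat (m - 1) (\<lambda>a b. M (skip i a) (skip i b)))"
proof -
  let ?A = "mat m m (\<lambda>(i, j). M i j)"
  have A: "?A \<in> carrier_mat m m" by simp
  have col: "(\<Sum>l<m. M i l * adj_mat ?A $$ (l, j)) = (if i = j then det_nat m M else 0)"
    if ij: "i < m" "j < m" for i j
  proof -
    have "(\<Sum>l<m. M i l * adj_mat ?A $$ (l, j)) = (?A * adj_mat ?A) $$ (i, j)"
      using ij adj_mat(1)[OF A] by (auto simp: scalar_prod_def lessThan_atLeast0 intro!: sum.cong)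
    also have "\<dots> = (if i = j then det_nat m M else 0)"
      using ij by (simp add: adj_mat(2)[OF A] det_nat_eq_det)
    finally show ?thesis .
  qed
  have diag: "adj_mat ?A $$ (i, i) = det_nat (m - 1) (\<lambda>a b. M (skip i a) (skip i b))"
    if i: "i < m" for i
  proof -
    have "mat_delete ?A i i = mat (m - 1) (m - 1) (\<lambda>(a, b). M (skip i a) (skip i b))"
      using i by (intro eq_matI) (auto simp: mat_delete_def skip_def)
    then show ?thesis
      using i by (simp add: adj_mat_def cofactor_def det_nat_eq_det flip: mult_2)
  qed
  show ?thesis
    by (rule exI[of _ "\<lambda>i j. adj_mat ?A $$ (i, j)"]) (simp add: col diag)
qed

section \<open>Determinantal weights\<close>

text \<open>Fubini across two blocks of coordinates. Since f and g take arbitrary index functions as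
  arguments, \<open>fc\<close> and \<open>gc\<close> record which coordinates they read, so that
  \<open>merge\<close> can be removed.\<close>

lemma (in product_sigma_finite) nn_integral_PiM_mult_indep:
  assumes I: "finite I" and J: "finite J" and disj: "I \<inter> J = {}"
    and fm: "f \<in> borel_measurable (PiM (I \<union> J) M)" and gm: "g \<in> borel_measurable (PiM (I \<union> J) M)"
    and fI: "f \<in> borel_measurable (PiM I M)" and gJ: "g \<in> borel_measurable (PiM J M)"
    and fc: "\<And>x y. (\<And>i. i \<in> I \<Longrightarrow> x i = y i) \<Longrightarrow> f x = f y"
    and gc: "\<And>x y. (\<And>j. j \<in> J \<Longrightarrow> x j = y j) \<Longrightarrow> g x = g y"
  shows "(\<integral>\<^sup>+x. f x * g x \<partial>PiM (I \<union> J) M) = (\<integral>\<^sup>+x. f x \<partial>PiM I M) * (\<integral>\<^sup>+x. g x \<partial>PiM J M)"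
proof -
  have "(\<integral>\<^sup>+x. f x * g x \<partial>PiM (I \<union> J) M)
      = (\<integral>\<^sup>+x. (\<integral>\<^sup>+y. f (merge I J (x, y)) * g (merge I J (x, y)) \<partial>PiM J M) \<partial>PiM I M)"
    by (rule product_nn_integral_fold[OF disj I J borel_measurable_times_ennreal[OF fm gm]])
  also have "\<dots> = (\<integral>\<^sup>+x. (\<integral>\<^sup>+y. f x * g y \<partial>PiM J M) \<partial>PiM I M)"
  proof -
    have "f (merge I J (x, y)) = f x" "g (merge I J (x, y)) = g y" for x y
      using disj by (auto intro!: fc gc simp: merge_def)
    then show ?thesis by simp
  qed
  also have "\<dots> = (\<integral>\<^sup>+x. f x \<partial>PiM I M) * (\<integral>\<^sup>+x. g x \<partial>PiM J M)"
    by (simp add: nn_integral_cmult[OF gJ] nn_integral_multc[OF fI])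
  finally show ?thesis .
qed

lemma permutes_lessThan: "p permutes {..<k} \<Longrightarrow> i < k \<Longrightarrow> p i < (k::nat)"
  by (metis lessThan_iff permutes_in_image)

lemma det_nat_cong:
  assumes "\<And>i j. i < k \<Longrightarrow> j < k \<Longrightarrow> A i j = B i j"
  shows "det_nat k A = det_nat k B"
  unfolding det_nat_def
  by (intro sum.cong refl arg_cong2[of _ _ _ _ "(*)"] prod.cong assms)
    (auto simp: permutes_lessThan)

lemma det_nat_measurable:
  fixes A :: "'x \<Rightarrow> nat \<Rightarrow> nat \<Rightarrow> real"
  assumes "\<And>i j. i < k \<Longrightarrow> j < k \<Longrightarrow> (\<lambda>x. A x i j) \<in> borel_measurable M"
  shows "(\<lambda>x. det_nat k (A x)) \<in> borel_measurable M"
  unfolding det_nat_def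
  by (intro borel_measurable_sum borel_measurable_times borel_measurable_const borel_measurable_prod assms)
    (auto simp: permutes_lessThan)

lemma small_form_cong:
  assumes "\<And>k. k \<in> I \<Longrightarrow> v k = u k"
  shows "small_form m I v t = small_form m I u t"
  unfolding small_form_def using assms by (simp cong: sum.cong)

context isotropic_vectors
begin

text \<open>The squared determinant expands over pairs of permutations; by independence of the rows
  and orthonormality each pair integrates to 1 if p = q and to 0 otherwise. The column selection s
  covers the full determinant and its principal minors at once.\<close>

lemma nn_integral_det_sq:
  assumes \<kappa>: "inj_on \<kappa> {..<k}" and s: "inj_on s {..<k}" "s ` {..<k} \<subseteq> {..<m}"
  shows "(\<integral>\<^sup>+xs. ennreal ((det_nat k (\<lambda>i j. v (xs (\<kappa> i)) (s j)))\<^sup>2) \<partial>PiM (\<kappa> ` {..<k}) (\<lambda>_. \<nu>))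
    = ennreal (fact k)"
proof -
  interpret product_prob_space "\<lambda>_. \<nu>" "\<kappa> ` {..<k}" by standard
  let ?M = "PiM (\<kappa> ` {..<k}) (\<lambda>_. \<nu>)" and ?Perm = "{p. p permutes {..<k}}"
  \<comment> \<open>Inverse of \<kappa>: it lets the factors be indexed by the sampled points, as
    the product measure demands.\<close>
  define \<iota> where "\<iota> = the_inv_into {..<k} \<kappa>"
  have \<iota>: "\<iota> (\<kappa> i) = i" if "i < k" for i
    using that \<kappa> by (simp add: \<iota>_def the_inv_into_f_f)
  have fin: "finite ?Perm" by (simp add: finite_permutations)
  define F where "F = (\<lambda>p q l x. v x (s (p (\<iota> l))) * v x (s (q (\<iota> l))))"
  have sp: "s (p i) < m" if "p \<in> ?Perm" "i < k" for p i
    using that s(2) permutes_lessThan[of p k i] by auto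
  have F_int: "integrable \<nu> (F p q l)" if "p \<in> ?Perm" "q \<in> ?Perm" "l \<in> \<kappa> ` {..<k}" for p q l
    unfolding F_def using that \<iota> by (intro integrable_v_v sp) auto
  have expand: "(det_nat k (\<lambda>i j. v (xs (\<kappa> i)) (s j)))\<^sup>2
      = (\<Sum>p\<in>?Perm. \<Sum>q\<in>?Perm. of_int (sign p) * of_int (sign q) * (\<Prod>l\<in>\<kappa> ` {..<k}. F p q l (xs l)))" for xs
  proof -
    have "(\<Prod>l\<in>\<kappa> ` {..<k}. F p q l (xs l))
        = (\<Prod>i<k. v (xs (\<kappa> i)) (s (p i))) * (\<Prod>i<k. v (xs (\<kappa> i)) (s (q i)))" for p q
      by (simp add: prod.reindex[OF \<kappa>] F_def \<iota> prod.distrib)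
    then show ?thesis
      unfolding det_nat_def power2_eq_square sum_product by (simp add: mult_ac)
  qed
  have prod_int: "integrable ?M (\<lambda>xs. \<Prod>l\<in>\<kappa> ` {..<k}. F p q l (xs l))" if "p \<in> ?Perm" "q \<in> ?Perm" for p q
    using that by (intro product_integrable_prod F_int) auto
  have int: "(\<integral>xs. (\<Prod>l\<in>\<kappa> ` {..<k}. F p q l (xs l)) \<partial>?M) = (if p = q then 1 else 0)"
    if pq: "p \<in> ?Perm" "q \<in> ?Perm" for p q
  proof -
    have "(\<integral>xs. (\<Prod>l\<in>\<kappa> ` {..<k}. F p q l (xs l)) \<partial>?M) = (\<Prod>l\<in>\<kappa> ` {..<k}. \<integral>x. F p q l x \<partial>\<nu>)"
      using pq by (intro product_integral_prod F_int) auto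
    also have "\<dots> = (\<Prod>i<k. if p i = q i then 1 else 0)"
    proof -
      have "(s (p i) = s (q i)) = (p i = q i)" if "i < k" for i
        using pq that by (intro inj_on_eq_iff[OF s(1)]) (auto simp: permutes_lessThan)
      then show ?thesis
        using pq by (simp add: prod.reindex[OF \<kappa>] F_def \<iota> v_orthonormal sp)
    qed
    also have "\<dots> = (if p = q then 1 else 0)"
    proof (cases "p = q")
      case False
      then obtain i where "p i \<noteq> q i" by blast
      moreover have "i < k"
        using pq \<open>p i \<noteq> q i\<close> permutes_not_in[of p "{..<k}" i] permutes_not_in[of q "{..<k}" i]
        by (cases "i < k") auto
      ultimately show ?thesis using False by auto
    qed simp
    finally show ?thesis .
  qed
  have "(\<integral>\<^sup>+xs. ennreal ((det_nat k (\<lambda>i j. v (xs (\<kappa> i)) (s j)))\<^sup>2) \<partial>?M)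
     = ennreal (\<integral>xs. (det_nat k (\<lambda>i j. v (xs (\<kappa> i)) (s j)))\<^sup>2 \<partial>?M)"
  proof (rule nn_integral_eq_integral)
    show "integrable ?M (\<lambda>xs. (det_nat k (\<lambda>i j. v (xs (\<kappa> i)) (s j)))\<^sup>2)"
      unfolding expand by (intro Bochner_Integration.integrable_sum integrable_mult_right prod_int)
  qed simp
  also have "(\<integral>xs. (det_nat k (\<lambda>i j. v (xs (\<kappa> i)) (s j)))\<^sup>2 \<partial>?M)
     = (\<Sum>p\<in>?Perm. \<Sum>q\<in>?Perm. of_int (sign p) * of_int (sign q) * (if p = q then 1 else 0))"
  proof -
    have "(\<integral>xs. (\<Sum>p\<in>?Perm. \<Sum>q\<in>?Perm. of_int (sign p) * of_int (sign q) * (\<Prod>l\<in>\<kappa> ` {..<k}. F p q l (xs l))) \<partial>?M)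
      = (\<Sum>p\<in>?Perm. \<integral>xs. (\<Sum>q\<in>?Perm. of_int (sign p) * of_int (sign q) * (\<Prod>l\<in>\<kappa> ` {..<k}. F p q l (xs l))) \<partial>?M)"
      by (intro Bochner_Integration.integral_sum Bochner_Integration.integrable_sum integrable_mult_right prod_int)
    also have "\<dots> = (\<Sum>p\<in>?Perm. \<Sum>q\<in>?Perm. \<integral>xs. of_int (sign p) * of_int (sign q) * (\<Prod>l\<in>\<kappa> ` {..<k}. F p q l (xs l)) \<partial>?M)"
      by (intro sum.cong refl Bochner_Integration.integral_sum integrable_mult_right prod_int)
    also have "\<dots> = (\<Sum>p\<in>?Perm. \<Sum>q\<in>?Perm. of_int (sign p) * of_int (sign q) * (if p = q then 1 else 0))"
      by (intro sum.cong refl) (simp only: integral_mult_right_zero int)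
    finally show ?thesis unfolding expand .
  qed
  also have "\<dots> = (\<Sum>p\<in>?Perm. 1)"
  proof (rule sum.cong[OF refl])
    fix p assume p: "p \<in> ?Perm"
    have "(\<Sum>q\<in>?Perm. of_int (sign p) * of_int (sign q) * (if p = q then 1 else 0))
       = (\<Sum>q\<in>?Perm. if p = q then of_int (sign p) * of_int (sign p) else (0::real))"
      by (intro sum.cong) auto
    also have "\<dots> = of_int (sign p) * of_int (sign p)"
      using p fin by simp
    also have "\<dots> = 1" by (simp add: sign_def)
    finally show "(\<Sum>q\<in>?Perm. of_int (sign p) * of_int (sign q) * (if p = q then 1 else 0)) = (1::real)" .
  qed
  also have "\<dots> = fact k" by (simp add: card_permutations[of "{..<k}" k])
  finally show ?thesis .
qed

lemma gram_measurable:
  assumes "s ` {..<k} \<subseteq> {..<m}"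
  shows "(\<lambda>xs. det_nat k (\<lambda>i j. \<Sum>l<n. v (xs l) (s i) * v (xs l) (s j)))
    \<in> borel_measurable (PiM {..<n} (\<lambda>_. \<nu>))"
  using assms
  by (intro det_nat_measurable borel_measurable_sum borel_measurable_times product_measurable) auto

text \<open>Conditioning on the rows selected by an injection leaves the remaining points independent,
  so an event that forces a bad behaviour of every large enough set of points keeps a small
  probability under the determinantal weight.\<close>
lemma nn_integral_gram_le:
  assumes s: "inj_on s {..<k}" "s ` {..<k} \<subseteq> {..<m}" and "k \<le> n" and "0 \<le> \<epsilon>"
    and \<epsilon>: "\<And>I. I \<subseteq> {..<n} \<Longrightarrow> card I = n - k \<Longrightarrow>
      measure (PiM I (\<lambda>_. \<nu>)) {xs \<in> space (PiM I (\<lambda>_. \<nu>)). small_form m I (\<lambda>k. v (xs k)) t} \<le> \<epsilon>"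
  shows "(\<integral>\<^sup>+xs. ennreal (det_nat k (\<lambda>i j. \<Sum>l<n. v (xs l) (s i) * v (xs l) (s j)))
        * indicator {xs. small_form m {..<n} (\<lambda>k. v (xs k)) t} xs \<partial>PiM {..<n} (\<lambda>_. \<nu>))
      \<le> ennreal (fact n / fact (n - k) * \<epsilon>)"
    and "(\<integral>\<^sup>+xs. ennreal (det_nat k (\<lambda>i j. \<Sum>l<n. v (xs l) (s i) * v (xs l) (s j)))
        \<partial>PiM {..<n} (\<lambda>_. \<nu>)) = ennreal (fact n / fact (n - k))"
proof -
  interpret product_prob_space "\<lambda>_. \<nu>" "{..<n}" by standard
  let ?D = "\<lambda>\<kappa> xs. (det_nat k (\<lambda>i j. v (xs (\<kappa> i)) (s j)))\<^sup>2"
  let ?P = "PiM {..<n} (\<lambda>_. \<nu>)"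
  let ?I = "\<lambda>\<kappa>. {..<n} - \<kappa> ` {..<k}"
  have sm: "s j < m" if "j < k" for j using s that by auto
  have D_meas: "(\<lambda>xs. ennreal (?D \<kappa> xs)) \<in> borel_measurable (PiM J (\<lambda>_. \<nu>))" if "\<kappa> ` {..<k} \<subseteq> J" for \<kappa> J
    using that sm by (intro measurable_compose[OF _ measurable_ennreal] borel_measurable_power det_nat_measurable
       product_measurable) auto
  \<comment> \<open>The selected rows integrate to fact k independently of the function g of the
    other points, which keep their product law.\<close>
  have split: "(\<integral>\<^sup>+xs. ennreal (?D \<kappa> xs) * g xs \<partial>?P)
      = ennreal (fact k) * (\<integral>\<^sup>+xs. g xs \<partial>PiM (?I \<kappa>) (\<lambda>_. \<nu>))"
    if \<kappa>: "\<kappa> \<in> injections k n" and g: "g \<in> borel_measurable ?P" "g \<in> borel_measurable (PiM (?I \<kappa>) (\<lambda>_. \<nu>))"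
      and gc: "\<And>x y. (\<And>j. j \<in> ?I \<kappa> \<Longrightarrow> x j = y j) \<Longrightarrow> g x = g y" for \<kappa> and g :: "(nat \<Rightarrow> 'a) \<Rightarrow> ennreal"
  proof -
    have sub: "\<kappa> ` {..<k} \<subseteq> {..<n}" and inj: "inj_on \<kappa> {..<k}" using \<kappa> by (auto simp: injections_def)
    then have un: "\<kappa> ` {..<k} \<union> ?I \<kappa> = {..<n}" by auto
    have "(\<integral>\<^sup>+xs. ennreal (?D \<kappa> xs) * g xs \<partial>PiM (\<kappa> ` {..<k} \<union> ?I \<kappa>) (\<lambda>_. \<nu>))
      = (\<integral>\<^sup>+xs. ennreal (?D \<kappa> xs) \<partial>PiM (\<kappa> ` {..<k}) (\<lambda>_. \<nu>)) * (\<integral>\<^sup>+xs. g xs \<partial>PiM (?I \<kappa>) (\<lambda>_. \<nu>))"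
    proof (rule nn_integral_PiM_mult_indep)
      show "ennreal (?D \<kappa> x) = ennreal (?D \<kappa> y)" if "\<And>i. i \<in> \<kappa> ` {..<k} \<Longrightarrow> x i = y i" for x y
        using that by (intro arg_cong[of _ _ "\<lambda>d. ennreal (d\<^sup>2)"] det_nat_cong) auto
      show "(\<lambda>xs. ennreal (?D \<kappa> xs)) \<in> borel_measurable (PiM (\<kappa> ` {..<k} \<union> ?I \<kappa>) (\<lambda>_. \<nu>))"
        by (rule D_meas) simp
      show "(\<lambda>xs. ennreal (?D \<kappa> xs)) \<in> borel_measurable (PiM (\<kappa> ` {..<k}) (\<lambda>_. \<nu>))"
        by (rule D_meas) simp
      show "g \<in> borel_measurable (PiM (\<kappa> ` {..<k} \<union> ?I \<kappa>) (\<lambda>_. \<nu>))"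
        unfolding un by (rule g(1))
      show "g x = g y" if "\<And>j. j \<in> ?I \<kappa> \<Longrightarrow> x j = y j" for x y
        by (rule gc) (rule that)
    qed (simp_all add: g(2))
    then show ?thesis unfolding un nn_integral_det_sq[OF inj s] .
  qed
  have gram: "ennreal (det_nat k (\<lambda>i j. \<Sum>l<n. v (xs l) (s i) * v (xs l) (s j)))
      = (\<Sum>\<kappa>\<in>injections k n. ennreal (?D \<kappa> xs)) * ennreal (1 / fact k)" for xs
    unfolding det_nat_gram[where a = "\<lambda>l i. v (xs l) (s i)"]
    by (simp add: sum_nonneg sum_ennreal divide_inverse ennreal_mult)
  have total: "(\<integral>\<^sup>+xs. ennreal (det_nat k (\<lambda>i j. \<Sum>l<n. v (xs l) (s i) * v (xs l) (s j))) * g xs \<partial>?P)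
     = (\<Sum>\<kappa>\<in>injections k n. \<integral>\<^sup>+xs. ennreal (?D \<kappa> xs) * g xs \<partial>?P) * ennreal (1 / fact k)"
    if g: "g \<in> borel_measurable ?P" for g
  proof -
    have Dg: "(\<lambda>xs. ennreal (?D \<kappa> xs) * g xs) \<in> borel_measurable ?P" if "\<kappa> \<in> injections k n" for \<kappa>
      using that by (intro borel_measurable_times_ennreal g D_meas) (auto simp: injections_def)
    have "(\<integral>\<^sup>+xs. ennreal (det_nat k (\<lambda>i j. \<Sum>l<n. v (xs l) (s i) * v (xs l) (s j))) * g xs \<partial>?P)
      = (\<integral>\<^sup>+xs. (\<Sum>\<kappa>\<in>injections k n. ennreal (?D \<kappa> xs) * g xs) * ennreal (1 / fact k) \<partial>?P)"
      unfolding gram by (intro nn_integral_cong) (simp only: sum_distrib_right[symmetric], simp only: mult_ac)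
    also have "\<dots> = (\<integral>\<^sup>+xs. (\<Sum>\<kappa>\<in>injections k n. ennreal (?D \<kappa> xs) * g xs) \<partial>?P) * ennreal (1 / fact k)"
      by (rule nn_integral_multc) (intro borel_measurable_sum Dg)
    also have "(\<integral>\<^sup>+xs. (\<Sum>\<kappa>\<in>injections k n. ennreal (?D \<kappa> xs) * g xs) \<partial>?P)
      = (\<Sum>\<kappa>\<in>injections k n. \<integral>\<^sup>+xs. ennreal (?D \<kappa> xs) * g xs \<partial>?P)"
      by (rule nn_integral_sum) (rule Dg)
    finally show ?thesis .
  qed
  let ?bad = "\<lambda>I. {xs. small_form m I (\<lambda>k. v (xs k)) t}"
  have ind_meas: "indicator (?bad I) \<in> borel_measurable (PiM J (\<lambda>_. \<nu>))" if "I \<subseteq> J" "J \<subseteq> {..<n}" for I J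
    using small_form_measurable[of I J t] that finite_subset[of I "{..<n}"]
    by (auto simp: borel_measurable_indicator_iff pred_def Int_def conj_commute)
  have "(\<integral>\<^sup>+xs. ennreal (?D \<kappa> xs) * indicator (?bad {..<n}) xs \<partial>?P) \<le> ennreal (fact k * \<epsilon>)"
    if \<kappa>: "\<kappa> \<in> injections k n" for \<kappa>
  proof -
    interpret PI: product_prob_space "\<lambda>_. \<nu>" "?I \<kappa>" by standard
    have card: "card (?I \<kappa>) = n - k"
      using \<kappa> by (subst card_Diff_subset) (auto simp: injections_def card_image)
    \<comment> \<open>Forgetting the selected points can only enlarge the bad event, and afterwards
      it depends on the independent points alone.\<close>
    have "(\<integral>\<^sup>+xs. ennreal (?D \<kappa> xs) * indicator (?bad {..<n}) xs \<partial>?P)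
       \<le> (\<integral>\<^sup>+xs. ennreal (?D \<kappa> xs) * indicator (?bad (?I \<kappa>)) xs \<partial>?P)"
      by (intro nn_integral_mono mult_left_mono indicator_leI)
        (auto intro: small_form_mono[of "{..<n}" "?I \<kappa>" t t])
    also have "\<dots> = ennreal (fact k) * (\<integral>\<^sup>+xs. indicator (?bad (?I \<kappa>)) xs \<partial>PiM (?I \<kappa>) (\<lambda>_. \<nu>))"
    proof (rule split[OF \<kappa>])
      show "indicator (?bad (?I \<kappa>)) x = (indicator (?bad (?I \<kappa>)) y :: ennreal)"
        if "\<And>j. j \<in> ?I \<kappa> \<Longrightarrow> x j = y j" for x y
        using that small_form_cong[of "?I \<kappa>" "\<lambda>k. v (x k)" "\<lambda>k. v (y k)" m t] by (simp add: indicator_def)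
    qed (intro ind_meas; auto)+
    also have "(\<integral>\<^sup>+xs. indicator (?bad (?I \<kappa>)) xs \<partial>PiM (?I \<kappa>) (\<lambda>_. \<nu>))
       = (\<integral>\<^sup>+xs. indicator {xs \<in> space (PiM (?I \<kappa>) (\<lambda>_. \<nu>)). small_form m (?I \<kappa>) (\<lambda>k. v (xs k)) t} xs \<partial>PiM (?I \<kappa>) (\<lambda>_. \<nu>))"
      by (intro nn_integral_cong) (simp add: indicator_def)
    also have "\<dots> = emeasure (PiM (?I \<kappa>) (\<lambda>_. \<nu>)) {xs \<in> space (PiM (?I \<kappa>) (\<lambda>_. \<nu>)). small_form m (?I \<kappa>) (\<lambda>k. v (xs k)) t}"
      using small_form_measurable[of "?I \<kappa>" "?I \<kappa>" t] by (intro nn_integral_indicator) (simp add: pred_def)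
    also have "\<dots> \<le> ennreal \<epsilon>"
      unfolding PI.emeasure_eq_measure by (intro ennreal_leI \<epsilon>[OF _ card]) auto
    finally show ?thesis
      using \<open>0 \<le> \<epsilon>\<close> by (simp add: ennreal_mult mult_left_mono)
  qed
  note bad = this
  \<comment> \<open>There are n! / (n-k)! injections; the k! from each of them cancels the k! of the
    ordered Cauchy-Binet formula.\<close>
  have c: "ennreal (real (card (injections k n)) * fact k * x) * ennreal (1 / fact k)
      = ennreal (fact n / fact (n - k) * x)" if "0 \<le> x" for x
    using that \<open>k \<le> n\<close> by (simp add: card_injections flip: ennreal_mult)
  show "(\<integral>\<^sup>+xs. ennreal (det_nat k (\<lambda>i j. \<Sum>l<n. v (xs l) (s i) * v (xs l) (s j)))
        * indicator (?bad {..<n}) xs \<partial>?P) \<le> ennreal (fact n / fact (n - k) * \<epsilon>)"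
  proof -
    have "(\<Sum>\<kappa>\<in>injections k n. \<integral>\<^sup>+xs. ennreal (?D \<kappa> xs) * indicator (?bad {..<n}) xs \<partial>?P)
       \<le> of_nat (card (injections k n)) * ennreal (fact k * \<epsilon>)"
      by (rule sum_bounded_above) (rule bad)
    also have "\<dots> = ennreal (real (card (injections k n)) * fact k * \<epsilon>)"
      using \<open>0 \<le> \<epsilon>\<close> by (simp add: ennreal_of_nat_eq_real_of_nat mult_ac flip: ennreal_mult)
    finally show ?thesis
      unfolding total[OF ind_meas[OF subset_refl subset_refl]] c[OF \<open>0 \<le> \<epsilon>\<close>, symmetric]
      by (rule mult_right_mono) simp
  qed
  have one: "(\<integral>\<^sup>+xs. ennreal (?D \<kappa> xs) * 1 \<partial>?P) = ennreal (fact k)" if \<kappa>: "\<kappa> \<in> injections k n" for \<kappa>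
  proof -
    interpret PI: product_prob_space "\<lambda>_. \<nu>" "?I \<kappa>" by standard
    show ?thesis by (subst split[OF \<kappa>]) (simp_all add: PI.emeasure_space_1)
  qed
  have "(\<integral>\<^sup>+xs. ennreal (det_nat k (\<lambda>i j. \<Sum>l<n. v (xs l) (s i) * v (xs l) (s j))) * 1 \<partial>?P)
     = of_nat (card (injections k n)) * ennreal (fact k) * ennreal (1 / fact k)"
    by (subst total) (simp_all add: one[simplified])
  also have "\<dots> = ennreal (fact n / fact (n - k))"
    using c[of 1] by (simp add: ennreal_of_nat_eq_real_of_nat ennreal_mult)
  finally show "(\<integral>\<^sup>+xs. ennreal (det_nat k (\<lambda>i j. \<Sum>l<n. v (xs l) (s i) * v (xs l) (s j))) \<partial>?P)
     = ennreal (fact n / fact (n - k))" by simp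
qed

end

section \<open>Weighted least squares\<close>

lemma gram_quadratic_form:
  fixes n :: nat
  shows "(\<Sum>l<n. ip m (a l) x * ip m (a l) z) = (\<Sum>i<m. x i * (\<Sum>j<m. (\<Sum>l<n. a l i * a l j) * z j))"
proof -
  have "(\<Sum>l<n. ip m (a l) x * ip m (a l) z) = (\<Sum>l<n. \<Sum>i<m. x i * (a l i * ip m (a l) z))"
    unfolding ip_def[of m _ x] sum_distrib_right by (simp add: mult_ac)
  also have "\<dots> = (\<Sum>i<m. x i * (\<Sum>l<n. a l i * ip m (a l) z))"
    by (subst sum.swap) (simp add: sum_distrib_left)
  also have "\<dots> = (\<Sum>i<m. x i * (\<Sum>j<m. (\<Sum>l<n. a l i * a l j) * z j))"
  proof -
    have "(\<Sum>l<n. a l i * ip m (a l) z) = (\<Sum>j<m. (\<Sum>l<n. a l i * a l j) * z j)" for i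
      unfolding ip_def sum_distrib_left sum_distrib_right by (subst sum.swap) (simp add: mult_ac)
    then show ?thesis by simp
  qed
  finally show ?thesis .
qed

text \<open>\<open>c\<^sub>i det M = \<langle>c, M b\<rangle>\<close> for the \<open>i\<close>-th column \<open>b\<close> of the adjugate of the Gram matrix \<open>M\<close>,
  and \<open>\<langle>b, M b\<rangle> = det M\<close> times the minor, so this is the Cauchy--Schwarz inequality for \<open>M\<close>.\<close>
lemma gram_coefficient_bound:
  fixes a :: "nat \<Rightarrow> nat \<Rightarrow> real" and n :: nat
  defines "M \<equiv> \<lambda>i j. \<Sum>l<n. a l i * a l j"
  assumes det: "0 < det_nat m M" and i: "i < m"
  shows "det_nat m M * (c i)\<^sup>2 \<le> det_nat (m - 1) (\<lambda>p q. M (skip i p) (skip i q)) * (\<Sum>l<n. (ip m (a l) c)\<^sup>2)"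
proof -
  obtain B where B: "\<forall>i<m. \<forall>j<m. (\<Sum>l<m. M i l * B l j) = (if i = j then det_nat m M else 0)"
    and minor: "\<forall>i<m. B i i = det_nat (m - 1) (\<lambda>p q. M (skip i p) (skip i q))"
    using det_nat_adjugate[of m M] by blast
  let ?b = "\<lambda>j. B j i"
  have Mij: "(\<Sum>l<n. a l p * a l q) = M p q" for p q by (simp add: M_def)
  have col: "(\<Sum>l<n. ip m (a l) x * ip m (a l) ?b) = x i * det_nat m M" for x
  proof -
    have "(\<Sum>l<n. ip m (a l) x * ip m (a l) ?b) = (\<Sum>p<m. x p * (if p = i then det_nat m M else 0))"
      unfolding gram_quadratic_form Mij
      by (intro sum.cong refl) (use B i in auto)
    then show ?thesis using i by (simp add: if_distrib cong: if_cong)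
  qed
  have "(c i * det_nat m M)\<^sup>2 \<le> (\<Sum>l<n. (ip m (a l) c)\<^sup>2) * (\<Sum>l<n. (ip m (a l) ?b)\<^sup>2)"
    unfolding col[symmetric] by (rule Cauchy_Schwarz_ineq_sum)
  also have "(\<Sum>l<n. (ip m (a l) ?b)\<^sup>2) = B i i * det_nat m M"
    using col[of ?b] by (simp add: power2_eq_square)
  finally have "det_nat m M * (det_nat m M * (c i)\<^sup>2) \<le> det_nat m M * (B i i * (\<Sum>l<n. (ip m (a l) c)\<^sup>2))"
    by (simp add: power2_eq_square mult_ac)
  then show ?thesis
    using det minor i by simp
qed

text \<open>The sum of the coordinate bounds; the principal minors add up to the trace of the
  adjugate, that is, to det M tr M^(-1).\<close>

lemma gram_form_bound:
  fixes a :: "nat \<Rightarrow> nat \<Rightarrow> real" and n :: nat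
  defines "M \<equiv> \<lambda>i j. \<Sum>l<n. a l i * a l j"
  assumes det: "0 < det_nat m M"
  shows "det_nat m M * ip m c c
    \<le> (\<Sum>i<m. det_nat (m - 1) (\<lambda>p q. M (skip i p) (skip i q))) * (\<Sum>l<n. (ip m (a l) c)\<^sup>2)"
proof -
  have "det_nat m M * ip m c c = (\<Sum>i<m. det_nat m M * (c i)\<^sup>2)"
    by (simp add: ip_def power2_eq_square sum_distrib_left)
  also have "\<dots> \<le> (\<Sum>i<m. det_nat (m - 1) (\<lambda>p q. M (skip i p) (skip i q)) * (\<Sum>l<n. (ip m (a l) c)\<^sup>2))"
    unfolding M_def
    by (intro sum_mono gram_coefficient_bound) (use det in \<open>auto simp: M_def\<close>)
  finally show ?thesis by (simp add: sum_distrib_right)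
qed

text \<open>The vector c solves the normal equations by means of the adjugate divided by the
  determinant, so the residual is orthogonal to the range of the design matrix and the cross term
  vanishes.\<close>

lemma least_squares_Pythagoras:
  fixes a :: "nat \<Rightarrow> nat \<Rightarrow> real" and n :: nat and y :: "nat \<Rightarrow> real"
  assumes det: "0 < det_nat m (\<lambda>i j. \<Sum>l<n. a l i * a l j)"
  obtains c where "\<And>d. (\<Sum>l<n. (y l - ip m (a l) d)\<^sup>2)
    = (\<Sum>l<n. (y l - ip m (a l) c)\<^sup>2) + (\<Sum>l<n. (ip m (a l) (\<lambda>i. c i - d i))\<^sup>2)"
proof -
  let ?M = "\<lambda>i j. \<Sum>l<n. a l i * a l j"
  obtain B where B: "\<forall>i<m. \<forall>j<m. (\<Sum>l<m. ?M i l * B l j) = (if i = j then det_nat m ?M else 0)"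
    using det_nat_adjugate[of m ?M] by blast
  define b where "b = (\<lambda>i. \<Sum>l<n. y l * a l i)"
  define c where "c = (\<lambda>p. \<Sum>j<m. B p j * (b j / det_nat m ?M))"
  have normal: "(\<Sum>p<m. ?M i p * c p) = b i" if i: "i < m" for i
  proof -
    have "(\<Sum>p<m. ?M i p * c p) = (\<Sum>j<m. (\<Sum>p<m. ?M i p * B p j) * (b j / det_nat m ?M))"
      unfolding c_def sum_distrib_left[of "?M i _"] sum_distrib_right[of _ _ "b _ / _"]
      by (subst sum.swap) (simp add: mult_ac)
    also have "\<dots> = (\<Sum>j<m. if i = j then b j else 0)"
      using det i by (intro sum.cong) (simp_all add: B)
    finally show ?thesis using i by simp
  qed
  have orth: "(\<Sum>l<n. (y l - ip m (a l) c) * ip m (a l) e) = 0" for e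
  proof -
    have "(\<Sum>l<n. y l * ip m (a l) e) = (\<Sum>i<m. e i * b i)"
      unfolding b_def ip_def sum_distrib_left by (subst sum.swap) (simp add: mult_ac)
    moreover have "(\<Sum>l<n. ip m (a l) e * ip m (a l) c) = (\<Sum>i<m. e i * b i)"
      unfolding gram_quadratic_form by (intro sum.cong refl) (simp add: normal)
    ultimately show ?thesis unfolding left_diff_distrib sum_subtractf by (simp add: mult.commute)
  qed
  have "(\<Sum>l<n. (y l - ip m (a l) d)\<^sup>2)
    = (\<Sum>l<n. (y l - ip m (a l) c)\<^sup>2) + (\<Sum>l<n. (ip m (a l) (\<lambda>i. c i - d i))\<^sup>2)" for d
  proof -
    have e: "ip m (a l) d = ip m (a l) c - ip m (a l) (\<lambda>i. c i - d i)" for l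
      by (simp add: ip_def right_diff_distrib sum_subtractf)
    have "(y l - ip m (a l) d)\<^sup>2 = (y l - ip m (a l) c)\<^sup>2 + (ip m (a l) (\<lambda>i. c i - d i))\<^sup>2
        + 2 * ((y l - ip m (a l) c) * ip m (a l) (\<lambda>i. c i - d i))" for l
      unfolding e by (simp add: power2_eq_square algebra_simps)
    then show ?thesis
      by (simp add: sum.distrib orth flip: sum_distrib_left)
  qed
  then show thesis by (rule that)
qed

text \<open>A positive determinant makes the minimizer unique, which is what the definite
  description needs. The second property is Pythagoras with the residual of c dropped: in empirical
  norm the projection is no farther from a competitor than f is.\<close>

lemma wls_proj_coefficients:
  fixes \<phi> :: "nat \<Rightarrow> 'a \<Rightarrow> real" and n :: nat
  assumes w: "\<And>x. 0 < w x" and n: "0 < n"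
    and det: "0 < det_nat m (\<lambda>i j. \<Sum>l<n. Phi \<phi> w xs l i * Phi \<phi> w xs l j)"
  obtains c where "wls_proj n m \<phi> w xs f = (\<lambda>x. \<Sum>i<m. c i * \<phi> i x)"
    and "\<And>d. (\<Sum>l<n. (ip m (Phi \<phi> w xs l) (\<lambda>i. c i - d i))\<^sup>2)
      \<le> (\<Sum>l<n. (f (xs l) - (\<Sum>i<m. d i * \<phi> i (xs l)))\<^sup>2 / w (xs l))"
proof -
  let ?a = "Phi \<phi> w xs"
  obtain c where c: "\<And>d. (\<Sum>l<n. (w (xs l) powr (-1/2) * f (xs l) - ip m (?a l) d)\<^sup>2)
    = (\<Sum>l<n. (w (xs l) powr (-1/2) * f (xs l) - ip m (?a l) c)\<^sup>2) + (\<Sum>l<n. (ip m (?a l) (\<lambda>i. c i - d i))\<^sup>2)"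
    by (rule least_squares_Pythagoras[OF det, where y = "\<lambda>l. w (xs l) powr (-1/2) * f (xs l)"]) blast
  have weighted: "(\<Sum>l<n. (f (xs l) - (\<Sum>i<m. d i * \<phi> i (xs l)))\<^sup>2 / w (xs l))
      = (\<Sum>l<n. (w (xs l) powr (-1/2) * f (xs l) - ip m (?a l) d)\<^sup>2)" for d
  proof (rule sum.cong[OF refl])
    fix l
    have sq: "(w (xs l) powr (-1/2))\<^sup>2 = 1 / w (xs l)"
      using w[of "xs l"] by (simp add: power2_eq_square powr_minus_divide flip: powr_add)
    have "w (xs l) powr (-1/2) * f (xs l) - ip m (?a l) d
        = w (xs l) powr (-1/2) * (f (xs l) - (\<Sum>i<m. d i * \<phi> i (xs l)))"
      by (simp add: ip_def Phi_def right_diff_distrib sum_distrib_left mult_ac)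
    then show "(f (xs l) - (\<Sum>i<m. d i * \<phi> i (xs l)))\<^sup>2 / w (xs l)
        = (w (xs l) powr (-1/2) * f (xs l) - ip m (?a l) d)\<^sup>2"
      by (simp only: power_mult_distrib sq) simp
  qed
  have emp: "emp_sqnorm n w xs (\<lambda>x. f x - (\<Sum>i<m. d i * \<phi> i x))
     = (1 / real n) * (\<Sum>l<n. (w (xs l) powr (-1/2) * f (xs l) - ip m (?a l) d)\<^sup>2)" for d
    unfolding emp_sqnorm_def weighted ..
  have le: "emp_sqnorm n w xs (\<lambda>x. f x - (\<Sum>i<m. c i * \<phi> i x)) \<le> emp_sqnorm n w xs (\<lambda>x. f x - (\<Sum>i<m. d i * \<phi> i x))" for d
    unfolding emp
  proof (rule mult_left_mono)
    show "(\<Sum>l<n. (w (xs l) powr (-1/2) * f (xs l) - ip m (?a l) c)\<^sup>2)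
      \<le> (\<Sum>l<n. (w (xs l) powr (-1/2) * f (xs l) - ip m (?a l) d)\<^sup>2)"
      unfolding c[of d] by (simp add: sum_nonneg)
  qed simp
  have "wls_proj n m \<phi> w xs f = (\<lambda>x. \<Sum>i<m. c i * \<phi> i x)"
    unfolding wls_proj_def
  proof (rule the_equality, intro conjI ballI)
    show "(\<lambda>x. \<Sum>i<m. c i * \<phi> i x) \<in> Vspace m \<phi>" by (auto simp: Vspace_def)
    show "emp_sqnorm n w xs (\<lambda>x. f x - (\<Sum>i<m. c i * \<phi> i x)) \<le> emp_sqnorm n w xs (\<lambda>x. f x - g' x)"
      if "g' \<in> Vspace m \<phi>" for g'
      using that le by (auto simp: Vspace_def)
    \<comment> \<open>Uniqueness: another minimizer has the same residual, so the Gram form vanishes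
      on the difference of the coefficients, and \<open>gram_form_bound\<close> makes that
      difference zero.\<close>
    fix g assume g: "g \<in> Vspace m \<phi> \<and>
      (\<forall>g'\<in>Vspace m \<phi>. emp_sqnorm n w xs (\<lambda>x. f x - g x) \<le> emp_sqnorm n w xs (\<lambda>x. f x - g' x))"
    then obtain d where d: "g = (\<lambda>x. \<Sum>i<m. d i * \<phi> i x)" by (auto simp: Vspace_def)
    have "emp_sqnorm n w xs (\<lambda>x. f x - g x) \<le> emp_sqnorm n w xs (\<lambda>x. f x - (\<Sum>i<m. c i * \<phi> i x))"
      using g by (auto simp: Vspace_def)
    then have "(\<Sum>l<n. (w (xs l) powr (-1/2) * f (xs l) - ip m (?a l) d)\<^sup>2)
       \<le> (\<Sum>l<n. (w (xs l) powr (-1/2) * f (xs l) - ip m (?a l) c)\<^sup>2)"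
      unfolding d emp using n by (simp add: divide_le_cancel)
    then have "(\<Sum>l<n. (ip m (?a l) (\<lambda>i. c i - d i))\<^sup>2) \<le> 0"
      unfolding c[of d] by simp
    then have z: "(\<Sum>l<n. (ip m (?a l) (\<lambda>i. c i - d i))\<^sup>2) = 0"
      by (intro antisym sum_nonneg) auto
    have "det_nat m (\<lambda>i j. \<Sum>l<n. ?a l i * ?a l j) * ip m (\<lambda>i. c i - d i) (\<lambda>i. c i - d i) \<le> 0"
      using gram_form_bound[OF det, of "\<lambda>i. c i - d i"] unfolding z by simp
    then have "ip m (\<lambda>i. c i - d i) (\<lambda>i. c i - d i) \<le> 0"
      using det by (simp add: mult_le_0_iff)
    then have "(\<Sum>i<m. (c i - d i) * (c i - d i)) = 0"
      unfolding ip_def by (intro antisym sum_nonneg) auto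
    then have "\<forall>i\<in>{..<m}. (c i - d i) * (c i - d i) = 0"
      by (subst (asm) sum_nonneg_eq_0_iff) auto
    then show "g = (\<lambda>x. \<Sum>i<m. c i * \<phi> i x)" unfolding d by auto
  qed
  then show thesis
  proof (rule that)
    show "(\<Sum>l<n. (ip m (?a l) (\<lambda>i. c i - d i))\<^sup>2)
      \<le> (\<Sum>l<n. (f (xs l) - (\<Sum>i<m. d i * \<phi> i (xs l)))\<^sup>2 / w (xs l))" for d
      unfolding weighted c[of d] by (simp add: sum_nonneg)
  qed
qed

section \<open>The L2 norm and the projection error\<close>

lemma L2_add:
  assumes "u \<in> L2 M" "v \<in> L2 M"
  shows "(\<lambda>x. u x + v x) \<in> L2 M"
proof -
  have [measurable]: "u \<in> borel_measurable M" "v \<in> borel_measurable M"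
    and int: "integrable M (\<lambda>x. 2 * (u x)\<^sup>2 + 2 * (v x)\<^sup>2)"
    using assms by (auto simp: L2_def)
  have "(u x + v x)\<^sup>2 \<le> 2 * (u x)\<^sup>2 + 2 * (v x)\<^sup>2" for x
    using sum_squares_bound[of "u x" "v x"] by (simp add: power2_sum)
  then have "integrable M (\<lambda>x. (u x + v x)\<^sup>2)"
    by (intro Bochner_Integration.integrable_bound[OF int]) auto
  then show ?thesis by (simp add: L2_def)
qed

lemma L2_scale: "u \<in> L2 M \<Longrightarrow> (\<lambda>x. c * u x) \<in> L2 M"
  by (auto simp: L2_def power_mult_distrib)

lemma L2_sum: "finite A \<Longrightarrow> (\<And>i. i \<in> A \<Longrightarrow> u i \<in> L2 M) \<Longrightarrow> (\<lambda>x. \<Sum>i\<in>A. u i x) \<in> L2 M"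
proof (induction A rule: finite_induct)
  case empty
  then show ?case by (simp add: L2_def)
next
  case (insert i A)
  then show ?case using L2_add[of "u i" M "\<lambda>x. \<Sum>i\<in>A. u i x"] by simp
qed

lemma L2_integrable_mult:
  assumes "u \<in> L2 M" "v \<in> L2 M"
  shows "integrable M (\<lambda>x. u x * v x)"
proof -
  have [measurable]: "u \<in> borel_measurable M" "v \<in> borel_measurable M"
    and int: "integrable M (\<lambda>x. (u x)\<^sup>2 + (v x)\<^sup>2)"
    using assms by (auto simp: L2_def)
  have "\<bar>u x * v x\<bar> \<le> (u x)\<^sup>2 + (v x)\<^sup>2" for x
  proof -
    have "0 \<le> \<bar>u x\<bar> * \<bar>v x\<bar>" by simp
    then show ?thesis
      using sum_squares_bound[of "\<bar>u x\<bar>" "\<bar>v x\<bar>"] unfolding abs_mult power2_abs by linarith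
  qed
  then show ?thesis by (intro Bochner_Integration.integrable_bound[OF int]) auto
qed

lemma L2norm_nonneg: "0 \<le> L2norm M u"
  by (simp add: L2norm_def)

lemma L2norm_sq: "(L2norm M u)\<^sup>2 = (\<integral>x. (u x)\<^sup>2 \<partial>M)"
  by (simp add: L2norm_def)

lemma L2norm_add_sq_le:
  assumes u: "u \<in> L2 M" and v: "v \<in> L2 M"
  shows "(L2norm M (\<lambda>x. u x + v x))\<^sup>2 \<le> (L2norm M u + L2norm M v)\<^sup>2"
proof -
  have int: "integrable M (\<lambda>x. (u x)\<^sup>2)" "integrable M (\<lambda>x. (v x)\<^sup>2)" "integrable M (\<lambda>x. u x * v x)"
    using assms L2_integrable_mult[OF u v] by (auto simp: L2_def)
  have quad: "(\<integral>x. (u x + t * v x)\<^sup>2 \<partial>M)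
      = (L2norm M u)\<^sup>2 + 2 * t * (\<integral>x. u x * v x \<partial>M) + t\<^sup>2 * (L2norm M v)\<^sup>2" for t
  proof -
    have "(u x + t * v x)\<^sup>2 = (u x)\<^sup>2 + (2 * t) * (u x * v x) + t\<^sup>2 * (v x)\<^sup>2" for x
      by (simp add: power2_eq_square algebra_simps)
    then show ?thesis using int by (simp add: L2norm_sq)
  qed
  have "(\<integral>x. u x * v x \<partial>M)\<^sup>2 \<le> (L2norm M u)\<^sup>2 * (L2norm M v)\<^sup>2"
  proof (rule discriminant_from_nonneg)
    show "0 \<le> (L2norm M u)\<^sup>2 + 2 * t * (\<integral>x. u x * v x \<partial>M) + t\<^sup>2 * (L2norm M v)\<^sup>2" for t
      unfolding quad[symmetric] by simp
  qed simp
  then have sq: "\<bar>\<integral>x. u x * v x \<partial>M\<bar>\<^sup>2 \<le> (L2norm M u * L2norm M v)\<^sup>2"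
    by (simp add: power_mult_distrib)
  have "\<bar>\<integral>x. u x * v x \<partial>M\<bar> \<le> L2norm M u * L2norm M v"
    by (rule power2_le_imp_le[OF sq]) (simp add: L2norm_nonneg)
  moreover have "(L2norm M (\<lambda>x. u x + v x))\<^sup>2 = (L2norm M u)\<^sup>2 + 2 * (\<integral>x. u x * v x \<partial>M) + (L2norm M v)\<^sup>2"
    using quad[of 1] by (simp add: L2norm_sq)
  ultimately show ?thesis by (simp add: power2_sum)
qed

lemma L2norm_orthonormal_comb:
  assumes "orthonormal_L2 M m \<phi>"
  shows "(L2norm M (\<lambda>x. \<Sum>i<m. e i * \<phi> i x))\<^sup>2 = ip m e e"
proof -
  have L2: "\<And>i. i < m \<Longrightarrow> \<phi> i \<in> L2 M"
    and on: "\<And>i j. i < m \<Longrightarrow> j < m \<Longrightarrow> (\<integral>x. \<phi> i x * \<phi> j x \<partial>M) = (if i = j then 1 else 0)"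
    using assms by (auto simp: orthonormal_L2_def)
  have "(L2norm M (\<lambda>x. \<Sum>i<m. e i * \<phi> i x))\<^sup>2 = (\<integral>x. (\<Sum>i<m. \<Sum>j<m. (e i * e j) * (\<phi> i x * \<phi> j x)) \<partial>M)"
    unfolding L2norm_sq unfolding power2_eq_square sum_product by (simp add: mult_ac)
  also have "\<dots> = (\<Sum>i<m. \<integral>x. (\<Sum>j<m. (e i * e j) * (\<phi> i x * \<phi> j x)) \<partial>M)"
    by (intro Bochner_Integration.integral_sum Bochner_Integration.integrable_sum integrable_mult_right
        L2_integrable_mult L2) auto
  also have "\<dots> = (\<Sum>i<m. \<Sum>j<m. \<integral>x. (e i * e j) * (\<phi> i x * \<phi> j x) \<partial>M)"
    by (intro sum.cong refl Bochner_Integration.integral_sum integrable_mult_right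
        L2_integrable_mult L2) auto
  also have "\<dots> = (\<Sum>i<m. \<Sum>j<m. if i = j then e i * e i else 0)"
    by (intro sum.cong refl) (simp add: on)
  also have "\<dots> = ip m e e" by (simp add: ip_def)
  finally show ?thesis .
qed

text \<open>Triangle inequality through g, where r is the L2 norm of g minus the projection of f.
  Parseval turns r into a length of coefficients, S compares it with the empirical norm, and the n
  weighted residuals are at most A each. S is left open so that both the good and the bad event can
  supply their own eigenvalue bound.\<close>

lemma wls_error_le:
  fixes n :: nat
  assumes on: "orthonormal_L2 \<mu> m \<phi>" and w: "\<And>x. 0 < w x" and n: "0 < n"
    and det: "0 < det_nat m (\<lambda>i j. \<Sum>l<n. Phi \<phi> w xs l i * Phi \<phi> w xs l j)"
    and g: "g \<in> Vspace m \<phi>" and u: "(\<lambda>x. f x - g x) \<in> L2 \<mu>"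
    and A: "\<And>l. l < n \<Longrightarrow> (f (xs l) - g (xs l))\<^sup>2 / w (xs l) \<le> A"
    and S: "0 < S" "\<And>e. S * ip m e e \<le> (\<Sum>l<n. (ip m (Phi \<phi> w xs l) e)\<^sup>2)"
  obtains r where "0 \<le> r" "r\<^sup>2 \<le> real n * A / S"
    "L2norm \<mu> (\<lambda>x. f x - wls_proj n m \<phi> w xs f x) \<le> L2norm \<mu> (\<lambda>x. f x - g x) + r"
proof -
  obtain d where d: "g = (\<lambda>x. \<Sum>i<m. d i * \<phi> i x)" using g by (auto simp: Vspace_def)
  obtain c where P: "wls_proj n m \<phi> w xs f = (\<lambda>x. \<Sum>i<m. c i * \<phi> i x)"
    and c: "\<And>d. (\<Sum>l<n. (ip m (Phi \<phi> w xs l) (\<lambda>i. c i - d i))\<^sup>2)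
      \<le> (\<Sum>l<n. (f (xs l) - (\<Sum>i<m. d i * \<phi> i (xs l)))\<^sup>2 / w (xs l))"
    by (rule wls_proj_coefficients[OF w n det, where f = f]) blast
  define e where "e = (\<lambda>i. d i - c i)"
  let ?r = "L2norm \<mu> (\<lambda>x. \<Sum>i<m. e i * \<phi> i x)"
  have "ip m e e = ip m (\<lambda>i. c i - d i) (\<lambda>i. c i - d i)"
    by (simp add: ip_def e_def algebra_simps)
  then have "S * ?r\<^sup>2 \<le> (\<Sum>l<n. (ip m (Phi \<phi> w xs l) (\<lambda>i. c i - d i))\<^sup>2)"
    unfolding L2norm_orthonormal_comb[OF on] using S(2) by simp
  also have "\<dots> \<le> (\<Sum>l<n. (f (xs l) - g (xs l))\<^sup>2 / w (xs l))" unfolding d by (rule c)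
  also have "\<dots> \<le> (\<Sum>l<n. A)" by (intro sum_mono A) auto
  finally have r: "?r\<^sup>2 \<le> real n * A / S" using S(1) by (simp add: field_simps)
  have "(\<lambda>x. \<Sum>i<m. e i * \<phi> i x) \<in> L2 \<mu>"
    using on by (intro L2_sum L2_scale) (auto simp: orthonormal_L2_def)
  then have "(L2norm \<mu> (\<lambda>x. (f x - g x) + (\<Sum>i<m. e i * \<phi> i x)))\<^sup>2 \<le> (L2norm \<mu> (\<lambda>x. f x - g x) + ?r)\<^sup>2"
    by (rule L2norm_add_sq_le[OF u])
  moreover have "(\<lambda>x. (f x - g x) + (\<Sum>i<m. e i * \<phi> i x)) = (\<lambda>x. f x - wls_proj n m \<phi> w xs f x)"
    by (simp add: P d e_def fun_eq_iff left_diff_distrib sum_subtractf)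
  ultimately have sq: "(L2norm \<mu> (\<lambda>x. f x - wls_proj n m \<phi> w xs f x))\<^sup>2 \<le> (L2norm \<mu> (\<lambda>x. f x - g x) + ?r)\<^sup>2"
    by simp
  have "L2norm \<mu> (\<lambda>x. f x - wls_proj n m \<phi> w xs f x) \<le> L2norm \<mu> (\<lambda>x. f x - g x) + ?r"
    by (rule power2_le_imp_le[OF sq]) (simp add: L2norm_nonneg)
  then show thesis using that[OF L2norm_nonneg r] by blast
qed

section \<open>The sampling measure\<close>

text \<open>Countably many approximants are enough to reach the infimum, and their exceptional null
  sets can be united.\<close>

lemma INF_approx_sequence:
  fixes F :: "'b \<Rightarrow> ennreal"
  assumes "(INF g\<in>V. F g) < \<infinity>"
  obtains G where "\<And>j. G j \<in> V" "\<And>j. F (G j) < \<infinity>"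
    "\<And>j. enn2real (F (G j)) \<le> enn2real (INF g\<in>V. F g) + 1 / real (Suc j)"
proof -
  let ?d = "INF g\<in>V. F g"
  have "\<exists>g\<in>V. F g < ?d + ennreal (1 / real (Suc j))" for j
  proof -
    have "?d < ?d + ennreal (1 / real (Suc j))"
      using assms by (cases "?d") (simp_all add: ennreal_less_iff flip: ennreal_plus)
    then show ?thesis by (simp add: INF_less_iff)
  qed
  then obtain G where G: "\<And>j. G j \<in> V" "\<And>j. F (G j) < ?d + ennreal (1 / real (Suc j))"
    by metis
  have fin: "F (G j) < \<infinity>" for j
    using less_trans[OF G(2)[of j], of \<infinity>] assms by simp
  have "enn2real (F (G j)) \<le> enn2real ?d + 1 / real (Suc j)" for j
  proof -
    have "enn2real (F (G j)) \<le> enn2real (?d + ennreal (1 / real (Suc j)))"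
      using G(2)[of j] assms by (intro enn2real_mono) auto
    also have "\<dots> = enn2real ?d + 1 / real (Suc j)"
      using assms by (subst enn2real_plus) auto
    finally show ?thesis .
  qed
  then show thesis using that G(1) fin by blast
qed

locale weighted_sampling = prob_space \<mu> for \<mu> :: "'a measure" +
  fixes m n :: nat and \<phi> :: "nat \<Rightarrow> 'a \<Rightarrow> real" and h :: "'a \<Rightarrow> real" and \<alpha> :: real
  assumes m_pos: "0 < m" and m_less_n: "m < n" and orthonormal: "orthonormal_L2 \<mu> m \<phi>"
    and h_measurable [measurable]: "h \<in> borel_measurable \<mu>" and h_pos: "\<And>x. 0 < h x"
    and h_integrable: "integrable \<mu> h" and h_integral: "(\<integral>x. h x \<partial>\<mu>) = 1"
    and alpha: "0 < \<alpha>" "\<alpha> < 1"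
begin

definition w :: "'a \<Rightarrow> real" where "w = (\<lambda>x. \<alpha> * wm m \<phi> x + (1 - \<alpha>) * h x)"

definition \<nu> :: "'a measure" where "\<nu> = density \<mu> (\<lambda>x. ennreal (w x))"

definition v :: "'a \<Rightarrow> nat \<Rightarrow> real" where "v x i = w x powr (-1/2) * \<phi> i x"

definition \<gamma> :: "(nat \<Rightarrow> 'a) measure" where "\<gamma> = gamma_n n m \<phi> w \<nu>"

abbreviation gram_det :: "(nat \<Rightarrow> 'a) \<Rightarrow> real" where
  "gram_det xs \<equiv> det_nat m (\<lambda>i j. \<Sum>l<n. v (xs l) i * v (xs l) j)"

abbreviation gram_minor :: "nat \<Rightarrow> (nat \<Rightarrow> 'a) \<Rightarrow> real" where
  "gram_minor i xs \<equiv> det_nat (m - 1) (\<lambda>p q. \<Sum>l<n. v (xs l) (skip i p) * v (xs l) (skip i q))"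

lemma Phi_eq: "Phi \<phi> w xs = (\<lambda>k. v (xs k))"
  by (simp add: Phi_def v_def fun_eq_iff)

lemma phi_L2: "i < m \<Longrightarrow> \<phi> i \<in> L2 \<mu>"
  using orthonormal by (simp add: orthonormal_L2_def)

lemma phi_measurable: "i < m \<Longrightarrow> \<phi> i \<in> borel_measurable \<mu>"
  using phi_L2 by (auto simp: L2_def)

lemma wm_nonneg: "0 \<le> wm m \<phi> x"
  by (simp add: wm_def sum_nonneg)

text \<open>The two components of the mixture have separate tasks: the part with h bounds the
  weighted residuals at the sample points, the part with \<open>wm\<close> (next lemma) bounds the
  length of the features.\<close>

lemma w_ge_h: "(1 - \<alpha>) * h x \<le> w x"
  using wm_nonneg alpha by (simp add: w_def)

lemma w_ge_wm: "\<alpha> * wm m \<phi> x \<le> w x"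
  using h_pos[of x] alpha by (simp add: w_def)

lemma w_pos: "0 < w x"
  using w_ge_h[of x] h_pos[of x] alpha mult_pos_pos[of "1 - \<alpha>" "h x"] by linarith

lemma wm_integrable: "integrable \<mu> (wm m \<phi>)" and wm_integral: "(\<integral>x. wm m \<phi> x \<partial>\<mu>) = 1"
proof -
  have int: "integrable \<mu> (\<lambda>x. (\<phi> i x)\<^sup>2)" "(\<integral>x. (\<phi> i x)\<^sup>2 \<partial>\<mu>) = 1" if "i < m" for i
    using that orthonormal by (auto simp: orthonormal_L2_def L2_def power2_eq_square)
  show "integrable \<mu> (wm m \<phi>)"
    unfolding wm_def[abs_def] by (intro integrable_mult_right Bochner_Integration.integrable_sum int) auto
  have "(\<integral>x. wm m \<phi> x \<partial>\<mu>) = (1 / real m) * (\<Sum>i<m. \<integral>x. (\<phi> i x)\<^sup>2 \<partial>\<mu>)"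
    unfolding wm_def by (simp add: Bochner_Integration.integral_sum int)
  then show "(\<integral>x. wm m \<phi> x \<partial>\<mu>) = 1" using m_pos by (simp add: int)
qed

lemma w_measurable [measurable]: "w \<in> borel_measurable \<mu>"
  using wm_integrable unfolding w_def by (auto simp: integrable_iff_bounded)

lemma w_integral: "integrable \<mu> w" "(\<integral>x. w x \<partial>\<mu>) = 1"
  unfolding w_def using wm_integrable h_integrable wm_integral h_integral by simp_all

lemma w_powr_sq: "w x powr (-1/2) * w x powr (-1/2) = 1 / w x"
  using w_pos[of x] by (simp add: powr_minus_divide flip: powr_add)

lemma prob_space_nu: "prob_space \<nu>"
proof
  have "emeasure \<nu> (space \<nu>) = (\<integral>\<^sup>+x. ennreal (w x) \<partial>\<mu>)"
    unfolding \<nu>_def by (simp add: emeasure_density cong: nn_integral_cong)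
  also have "\<dots> = ennreal (\<integral>x. w x \<partial>\<mu>)"
    by (rule nn_integral_eq_integral) (use w_integral w_pos in \<open>auto intro: less_imp_le\<close>)
  finally show "emeasure \<nu> (space \<nu>) = 1" by (simp add: w_integral)
qed

text \<open>The density w of \<nu> cancels the factor 1/w in products of two features, so
  orthonormality passes from \<mu> to \<nu>; the squared length of a feature is m \<open>wm\<close>
  / w.\<close>

sublocale V: isotropic_vectors \<nu> m "real m / \<alpha>" v
proof (intro isotropic_vectors.intro isotropic_vectors_axioms.intro prob_space_nu)
  show "0 < real m / \<alpha>" using m_pos alpha by simp
  show vm: "(\<lambda>x. v x i) \<in> borel_measurable \<nu>" if "i < m" for i
    unfolding \<nu>_def v_def using phi_measurable[OF that] by simp
  show "(\<integral>x. v x i * v x j \<partial>\<nu>) = (if i = j then 1 else 0)" if "i < m" "j < m" for i j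
  proof -
    have [measurable]: "(\<lambda>x. v x i * v x j) \<in> borel_measurable \<mu>"
      using borel_measurable_times[OF vm[OF that(1)] vm[OF that(2)]] by (simp add: \<nu>_def)
    have "(\<integral>x. v x i * v x j \<partial>\<nu>) = (\<integral>x. w x *\<^sub>R (v x i * v x j) \<partial>\<mu>)"
      unfolding \<nu>_def by (rule integral_density) (use w_pos in \<open>auto intro: less_imp_le\<close>)
    also have "\<dots> = (\<integral>x. \<phi> i x * \<phi> j x \<partial>\<mu>)"
    proof -
      have "w x *\<^sub>R (v x i * v x j) = \<phi> i x * \<phi> j x" for x
      proof -
        have "w x *\<^sub>R (v x i * v x j) = w x * (w x powr (-1/2) * w x powr (-1/2)) * (\<phi> i x * \<phi> j x)"
          by (simp add: v_def)
        then show ?thesis unfolding w_powr_sq using w_pos[of x] by simp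
      qed
      then show ?thesis by simp
    qed
    finally show ?thesis using that orthonormal by (simp add: orthonormal_L2_def)
  qed
  show "ip m (v x) (v x) \<le> real m / \<alpha>" for x
  proof -
    have "ip m (v x) (v x) = (w x powr (-1/2) * w x powr (-1/2)) * (\<Sum>i<m. (\<phi> i x)\<^sup>2)"
      unfolding ip_def v_def sum_distrib_left by (simp add: power2_eq_square mult_ac)
    also have "\<dots> = real m * wm m \<phi> x / w x"
      unfolding w_powr_sq using m_pos by (simp add: wm_def)
    also have "\<dots> \<le> real m / \<alpha>"
      using w_ge_wm[of x] w_pos[of x] alpha mult_left_mono[OF w_ge_wm[of x], of "real m"]
      by (simp add: field_simps)
    finally show ?thesis .
  qed
qed

abbreviation product where "product \<equiv> PiM {..<n} (\<lambda>_. \<nu>)"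

text \<open>More than n - m points are allowed because the minors select only m - 1 rows and leave n
  - m + 1 points free.\<close>

lemma prob_small_form_card_le:
  assumes \<delta>: "0 < \<delta>" "\<delta> < 1" and I: "finite (I :: nat set)" "n - m \<le> card I"
  shows "measure (PiM I (\<lambda>_. \<nu>)) {xs \<in> space (PiM I (\<lambda>_. \<nu>)).
      small_form m I (\<lambda>k. v (xs k)) ((1 - \<delta>) * real (n - m))}
    \<le> real m * exp (- c_delta \<delta> * real (n - m) * \<alpha> / real m)"
proof -
  let ?R = "real m / \<alpha>" and ?N = "real (n - m)"
  \<comment> \<open>The minimizer of \<theta> (1 - \<delta>) - (1 - exp(-\<theta> R)) / R: its
    derivative vanishes when exp(-\<theta> R) = 1 - \<delta>, and the minimum is - c_\<delta> /
    R.\<close>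
  define \<theta> where "\<theta> = - ln (1 - \<delta>) / ?R"
  have R: "0 < ?R" by (rule V.R_pos)
  have ln: "ln (1 - \<delta>) < 0" using \<delta> by simp
  have "measure (PiM I (\<lambda>_. \<nu>)) {xs \<in> space (PiM I (\<lambda>_. \<nu>)).
      small_form m I (\<lambda>k. v (xs k)) ((1 - \<delta>) * ?N)}
    \<le> real m * exp (\<theta> * ((1 - \<delta>) * ?N) - real (card I) * (1 - exp (- \<theta> * ?R)) / ?R)"
  proof (rule V.prob_small_form_le[OF I(1)])
    show "0 < \<theta>" unfolding \<theta>_def by (rule divide_pos_pos) (use R ln in auto)
  qed (use \<delta> in simp)
  also have "- \<theta> * ?R = ln (1 - \<delta>)" using m_pos alpha by (simp add: \<theta>_def)
  also have "exp (ln (1 - \<delta>)) = 1 - \<delta>" using \<delta> by simp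
  also have "real m * exp (\<theta> * ((1 - \<delta>) * ?N) - real (card I) * (1 - (1 - \<delta>)) / ?R)
     \<le> real m * exp (\<theta> * ((1 - \<delta>) * ?N) - ?N * \<delta> / ?R)"
  proof (intro mult_left_mono iffD2[OF exp_le_cancel_iff] diff_left_mono)
    have "?N * \<delta> / ?R \<le> real (card I) * \<delta> / ?R"
      using I(2) \<delta> R by (intro divide_right_mono mult_right_mono) auto
    then show "?N * \<delta> / ?R \<le> real (card I) * (1 - (1 - \<delta>)) / ?R" by simp
  qed simp
  also have "\<theta> * ((1 - \<delta>) * ?N) - ?N * \<delta> / ?R = - c_delta \<delta> * ?N * \<alpha> / real m"
    using m_pos alpha by (simp add: \<theta>_def c_delta_def field_simps)
  finally show ?thesis .
qed

text \<open>All n points enter the form, while the threshold counts only the n - m that remain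
  independent.\<close>

definition bad :: "real \<Rightarrow> (nat \<Rightarrow> 'a) set" where
  "bad \<delta> = {xs. small_form m {..<n} (\<lambda>k. v (xs k)) ((1 - \<delta>) * real (n - m))}"

lemma bad_measurable [measurable]: "Measurable.pred product (\<lambda>xs. xs \<in> bad \<delta>)"
  unfolding bad_def mem_Collect_eq by (rule V.small_form_measurable) auto

lemma skip_inj: "inj_on (skip i) A"
  by (auto simp: inj_on_def skip_def split: if_splits)

lemma skip_less: "skip i ` {..<m - 1} \<subseteq> {..<m}"
  by (auto simp: skip_def)

lemma gram_det_measurable [measurable]: "gram_det \<in> borel_measurable product"
  using V.gram_measurable[of "\<lambda>i. i" m n] by simp

lemma gram_minor_measurable [measurable]: "gram_minor i \<in> borel_measurable product"
  using V.gram_measurable[OF skip_less] by simp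

lemma nn_integral_gram_det_bad:
  assumes "0 < \<delta>" "\<delta> < 1"
  shows "(\<integral>\<^sup>+xs. ennreal (gram_det xs) * indicator (bad \<delta>) xs \<partial>product)
    \<le> ennreal (fact n / fact (n - m) * (real m * exp (- c_delta \<delta> * real (n - m) * \<alpha> / real m)))"
  unfolding bad_def
  by (rule V.nn_integral_gram_le(1)[of "\<lambda>i. i" m n, OF _ _ _ _ prob_small_form_card_le[OF assms]])
    (use m_less_n finite_subset[of _ "{..<n}"] in auto)

lemma nn_integral_gram_minor_bad:
  assumes "0 < \<delta>" "\<delta> < 1"
  shows "(\<integral>\<^sup>+xs. ennreal (gram_minor i xs) * indicator (bad \<delta>) xs \<partial>product)
    \<le> ennreal (fact n / fact (n - (m - 1)) * (real m * exp (- c_delta \<delta> * real (n - m) * \<alpha> / real m)))"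
  unfolding bad_def
  by (rule V.nn_integral_gram_le(1)[OF skip_inj skip_less _ _ prob_small_form_card_le[OF assms]])
    (use m_less_n finite_subset[of _ "{..<n}"] in auto)

lemma nn_integral_gram_det: "(\<integral>\<^sup>+xs. ennreal (gram_det xs) \<partial>product) = ennreal (fact n / fact (n - m))"
  by (rule V.nn_integral_gram_le(2)[of "\<lambda>i. i" m n 1 0, OF _ _ _ _ prob_space.prob_le_1])
    (use m_less_n in \<open>auto intro!: prob_space_PiM prob_space_nu\<close>)

lemma gamma_eq: "\<gamma> = density product (\<lambda>xs. ennreal (fact (n - m) / fact n * gram_det xs))"
  by (simp add: \<gamma>_def gamma_n_def Phi_eq)

lemma sets_gamma: "sets \<gamma> = sets product"
  by (simp add: gamma_eq)

lemma space_gamma: "space \<gamma> = space product"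
  by (simp add: gamma_eq)

lemma gram_det_nonneg: "0 \<le> gram_det xs"
  by (rule det_nat_gram_nonneg[where a = "\<lambda>l i. v (xs l) i"])

lemma gram_minor_nonneg: "0 \<le> gram_minor i xs"
  by (rule det_nat_gram_nonneg[where a = "\<lambda>l p. v (xs l) (skip i p)"])

lemma nn_integral_gamma:
  assumes [measurable]: "g \<in> borel_measurable product"
  shows "(\<integral>\<^sup>+xs. g xs \<partial>\<gamma>) = ennreal (fact (n - m) / fact n) * (\<integral>\<^sup>+xs. ennreal (gram_det xs) * g xs \<partial>product)"
proof -
  have "(\<integral>\<^sup>+xs. g xs \<partial>\<gamma>) = (\<integral>\<^sup>+xs. ennreal (fact (n - m) / fact n * gram_det xs) * g xs \<partial>product)"
    unfolding gamma_eq by (rule nn_integral_density) measurable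
  also have "\<dots> = (\<integral>\<^sup>+xs. ennreal (fact (n - m) / fact n) * (ennreal (gram_det xs) * g xs) \<partial>product)"
    by (intro nn_integral_cong, subst ennreal_mult) (simp_all only: gram_det_nonneg mult.assoc, simp)
  also have "\<dots> = ennreal (fact (n - m) / fact n) * (\<integral>\<^sup>+xs. ennreal (gram_det xs) * g xs \<partial>product)"
    by (rule nn_integral_cmult) measurable
  finally show ?thesis .
qed

lemma prob_space_gamma: "prob_space \<gamma>"
proof
  have "emeasure \<gamma> (space \<gamma>) = (\<integral>\<^sup>+xs. 1 \<partial>\<gamma>)" by simp
  also have "\<dots> = 1"
    by (subst nn_integral_gamma) (simp_all add: nn_integral_gram_det flip: ennreal_mult)
  finally show "emeasure \<gamma> (space \<gamma>) = 1" .
qed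

sublocale G: prob_space \<gamma> by (rule prob_space_gamma)

lemma prob_bad_le:
  assumes "0 < \<delta>" "\<delta> < 1"
  shows "measure \<gamma> (bad \<delta> \<inter> space \<gamma>) \<le> real m * exp (- c_delta \<delta> * real (n - m) * \<alpha> / real m)"
proof -
  have [measurable]: "bad \<delta> \<inter> space \<gamma> \<in> sets \<gamma>"
    using bad_measurable[of \<delta>] by (simp add: sets_gamma space_gamma pred_def Int_def conj_commute)
  have "emeasure \<gamma> (bad \<delta> \<inter> space \<gamma>) = (\<integral>\<^sup>+xs. indicator (bad \<delta> \<inter> space \<gamma>) xs \<partial>\<gamma>)"
    by (rule nn_integral_indicator[symmetric]) measurable
  also have "\<dots> = (\<integral>\<^sup>+xs. indicator (bad \<delta>) xs \<partial>\<gamma>)"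
    by (intro nn_integral_cong) (simp add: indicator_def)
  also have "\<dots> \<le> ennreal (fact (n - m) / fact n) *
    ennreal (fact n / fact (n - m) * (real m * exp (- c_delta \<delta> * real (n - m) * \<alpha> / real m)))"
    by (subst nn_integral_gamma) (measurable, intro mult_left_mono nn_integral_gram_det_bad assms, simp)
  also have "\<dots> = ennreal (real m * exp (- c_delta \<delta> * real (n - m) * \<alpha> / real m))"
    by (simp flip: ennreal_mult)
  finally show ?thesis by (simp add: G.emeasure_eq_measure)
qed

text \<open>The density of \<gamma> is a multiple of this determinant, so its zero set carries no
  mass.\<close>

lemma AE_gram_det_pos: "AE xs in \<gamma>. 0 < gram_det xs"
  unfolding gamma_eq by (subst AE_density) (auto simp: zero_less_divide_iff zero_less_mult_iff)

text \<open>The law \<gamma> is absolutely continuous with respect to the product of \<nu>, and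
  \<nu> with respect to \<mu>. This carries essential bounds for functions in H over to the finitely
  many sample points.\<close>

lemma AE_gamma_components:
  assumes "AE x in \<mu>. Q x"
  shows "AE xs in \<gamma>. \<forall>l<n. Q (xs l)"
proof -
  have "AE x in \<nu>. Q x" unfolding \<nu>_def using assms by (subst AE_density) auto
  then have "AE xs in product. Q (xs l)" if "l < n" for l
    using that by (intro AE_PiM_component prob_space_nu) auto
  then have "AE xs in product. \<forall>l\<in>{..<n}. Q (xs l)"
    by (intro AE_finite_allI) auto
  then show ?thesis unfolding gamma_eq by (subst AE_density) auto
qed

end

section \<open>Error bounds\<close>

text \<open>This is ln(1 + x) < x at x = \<delta> / (1 - \<delta>), where 1 + x = 1 / (1 -
  \<delta>).\<close>

lemma c_delta_pos:
  assumes "0 < \<delta>" "\<delta> < 1"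
  shows "0 < c_delta \<delta>"
proof -
  have "ln (1 + \<delta> / (1 - \<delta>)) < \<delta> / (1 - \<delta>)"
    using assms by (intro ln_add_one_self_less_self) simp
  moreover have "1 + \<delta> / (1 - \<delta>) = 1 / (1 - \<delta>)"
    using assms by (simp add: field_simps)
  ultimately have "- ln (1 - \<delta>) < \<delta> / (1 - \<delta>)"
    using assms by (simp add: ln_div)
  then have "(1 - \<delta>) * (- ln (1 - \<delta>)) < (1 - \<delta>) * (\<delta> / (1 - \<delta>))"
    using assms by (intro mult_strict_left_mono) simp_all
  then show ?thesis using assms by (simp add: c_delta_def)
qed

lemma powr_neg_half_sq: "0 < (x::real) \<Longrightarrow> (x powr (-1/2))\<^sup>2 = 1 / x"
  by (simp add: power2_eq_square powr_minus_divide flip: powr_add)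

context weighted_sampling
begin

lemma sq_div_w_le:
  assumes "y\<^sup>2 \<le> a\<^sup>2 * h x"
  shows "y\<^sup>2 / w x \<le> a\<^sup>2 / (1 - \<alpha>)"
proof -
  have "y\<^sup>2 * (1 - \<alpha>) \<le> a\<^sup>2 * ((1 - \<alpha>) * h x)"
    using mult_right_mono[OF assms, of "1 - \<alpha>"] alpha by (simp add: mult_ac)
  also have "\<dots> \<le> a\<^sup>2 * w x" by (intro mult_left_mono w_ge_h) simp
  finally show ?thesis using w_pos[of x] alpha by (simp add: field_simps)
qed

lemma wls_error_good:
  assumes \<delta>: "0 < \<delta>" "\<delta> < 1" and det: "0 < gram_det xs" and good: "xs \<notin> bad \<delta>"
    and g: "g \<in> Vspace m \<phi>" and u: "(\<lambda>x. f x - g x) \<in> L2 \<mu>"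
    and a: "\<And>l. l < n \<Longrightarrow> (f (xs l) - g (xs l))\<^sup>2 \<le> a\<^sup>2 * h (xs l)"
  obtains r where "0 \<le> r" "r\<^sup>2 \<le> a\<^sup>2 / (1 - \<alpha>) * (1 / (1 - \<delta>) * (1 / (1 - real m / real n)))"
    "L2norm \<mu> (\<lambda>x. f x - wls_proj n m \<phi> w xs f x) \<le> L2norm \<mu> (\<lambda>x. f x - g x) + r"
proof -
  let ?S = "(1 - \<delta>) * real (n - m)"
  have S: "0 < ?S" using \<delta> m_less_n by simp
  obtain r where r: "0 \<le> r" "r\<^sup>2 \<le> real n * (a\<^sup>2 / (1 - \<alpha>)) / ?S"
    "L2norm \<mu> (\<lambda>x. f x - wls_proj n m \<phi> w xs f x) \<le> L2norm \<mu> (\<lambda>x. f x - g x) + r"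
  proof (rule wls_error_le[OF orthonormal w_pos _ _ g u _ S, where A = "a\<^sup>2 / (1 - \<alpha>)" and n = n and xs = xs])
    show "?S * ip m e e \<le> (\<Sum>l<n. (ip m (Phi \<phi> w xs l) e)\<^sup>2)" for e
      unfolding Phi_eq using good by (intro not_small_form_ge) (simp add: bad_def)
  qed (use m_less_n det a in \<open>auto simp: Phi_eq intro!: sq_div_w_le\<close>)
  have eq: "real n * (a\<^sup>2 / (1 - \<alpha>)) / ?S = a\<^sup>2 / (1 - \<alpha>) * (1 / (1 - \<delta>) * (1 / (1 - real m / real n)))"
  proof -
    have "1 - real m / real n = real (n - m) / real n" using m_less_n by (simp add: field_simps)
    then show ?thesis using m_less_n by simp
  qed
  show thesis by (rule that[OF r(1) r(2)[unfolded eq] r(3)])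
qed

lemma wls_error_bad:
  assumes det: "0 < gram_det xs"
    and g: "g \<in> Vspace m \<phi>" and u: "(\<lambda>x. f x - g x) \<in> L2 \<mu>"
    and a: "\<And>l. l < n \<Longrightarrow> (f (xs l) - g (xs l))\<^sup>2 \<le> a\<^sup>2 * h (xs l)"
  obtains r where "0 \<le> r" "r\<^sup>2 \<le> a\<^sup>2 / (1 - \<alpha>) * (real n * (\<Sum>i<m. gram_minor i xs) / gram_det xs)"
    "L2norm \<mu> (\<lambda>x. f x - wls_proj n m \<phi> w xs f x) \<le> L2norm \<mu> (\<lambda>x. f x - g x) + r"
proof -
  let ?T = "\<Sum>i<m. gram_minor i xs"
  have bound: "gram_det xs * ip m e e \<le> ?T * (\<Sum>l<n. (ip m (v (xs l)) e)\<^sup>2)" for e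
    by (rule gram_form_bound[OF det])
  \<comment> \<open>If the minors summed to zero, the bound at the first unit vector would
    contradict the positive determinant; m > 0 provides that vector.\<close>
  have "?T \<noteq> 0"
  proof
    assume "?T = 0"
    then show False using bound[of "unit_vec_at 0"] det m_pos
      by (simp add: ip_unit_vec_at) (simp add: unit_vec_at_def)
  qed
  moreover have "0 \<le> ?T" by (intro sum_nonneg gram_minor_nonneg)
  ultimately have T: "0 < ?T" by simp
  have S: "0 < gram_det xs / ?T" using det T by simp
  obtain r where r: "0 \<le> r" "r\<^sup>2 \<le> real n * (a\<^sup>2 / (1 - \<alpha>)) / (gram_det xs / ?T)"
    "L2norm \<mu> (\<lambda>x. f x - wls_proj n m \<phi> w xs f x) \<le> L2norm \<mu> (\<lambda>x. f x - g x) + r"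
  proof (rule wls_error_le[OF orthonormal w_pos _ _ g u _ S, where A = "a\<^sup>2 / (1 - \<alpha>)" and n = n and xs = xs])
    show "gram_det xs / ?T * ip m e e \<le> (\<Sum>l<n. (ip m (Phi \<phi> w xs l) e)\<^sup>2)" for e
      using bound[of e] T by (simp add: Phi_eq pos_divide_le_eq mult.commute)
  qed (use m_less_n det a in \<open>auto simp: Phi_eq intro!: sq_div_w_le\<close>)
  have eq: "real n * (a\<^sup>2 / (1 - \<alpha>)) / (gram_det xs / ?T) = a\<^sup>2 / (1 - \<alpha>) * (real n * ?T / gram_det xs)"
    by simp
  show thesis by (rule that[OF r(1) r(2)[unfolded eq] r(3)])
qed

text \<open>The determinant in the density cancels the denominator. Each of the m minors then
  contributes at most n! / (n-m+1)! times the failure probability bound, which the size condition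
  makes at most 1 / (n m).\<close>

lemma nn_integral_minor_ratio_le_1:
  assumes \<delta>: "0 < \<delta>" "\<delta> < 1"
    and n: "real n \<ge> real m + (1 / c_delta \<delta>) * (1 / \<alpha>) * real m * ln (real n * real m ^ 2)"
  shows "(\<integral>\<^sup>+xs. ennreal (real n * (\<Sum>i<m. gram_minor i xs) / gram_det xs) * indicator (bad \<delta>) xs \<partial>\<gamma>) \<le> 1"
proof -
  let ?\<epsilon> = "real m * exp (- c_delta \<delta> * real (n - m) * \<alpha> / real m)"
  let ?K = "fact (n - m) / fact n :: real"
  \<comment> \<open>Solved for the exponential, the size condition reads exp(...) \<le> 1 / (n m^2);
    the prefactor m of the Chernoff bound removes one power of m.\<close>
  have eps: "?\<epsilon> \<le> 1 / (real n * real m)"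
  proof -
    have c: "0 < c_delta \<delta>" by (rule c_delta_pos[OF \<delta>])
    have "(1 / c_delta \<delta>) * (1 / \<alpha>) * real m * ln (real n * real m ^ 2) \<le> real (n - m)"
      using n m_less_n by simp
    then have "ln (real n * real m ^ 2) \<le> c_delta \<delta> * real (n - m) * \<alpha> / real m"
      using c alpha m_pos by (simp add: field_simps)
    then have "exp (- (c_delta \<delta> * real (n - m) * \<alpha> / real m)) \<le> exp (- ln (real n * real m ^ 2))"
      by simp
    also have "\<dots> = 1 / (real n * real m ^ 2)"
      using m_pos m_less_n by (simp add: exp_minus divide_inverse)
    finally have "?\<epsilon> \<le> real m * (1 / (real n * real m ^ 2))"
      by (intro mult_left_mono) simp_all
    then show ?thesis using m_pos by (simp add: power2_eq_square)
  qed
  have ind: "indicator (bad \<delta>) \<in> borel_measurable product"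
    using bad_measurable[of \<delta>] by (auto simp: borel_measurable_indicator_iff pred_def Int_def conj_commute)
  have "(\<integral>\<^sup>+xs. ennreal (real n * (\<Sum>i<m. gram_minor i xs) / gram_det xs) * indicator (bad \<delta>) xs \<partial>\<gamma>)
    = ennreal ?K * (\<integral>\<^sup>+xs. ennreal (gram_det xs) *
        (ennreal (real n * (\<Sum>i<m. gram_minor i xs) / gram_det xs) * indicator (bad \<delta>) xs) \<partial>product)"
    by (rule nn_integral_gamma) (intro borel_measurable_times_ennreal ind, measurable)
  also have "\<dots> \<le> ennreal ?K * (\<integral>\<^sup>+xs. ennreal (real n) *
        (\<Sum>i<m. ennreal (gram_minor i xs) * indicator (bad \<delta>) xs) \<partial>product)"
  proof (intro mult_left_mono nn_integral_mono)
    fix xs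
    have T: "0 \<le> (\<Sum>i<m. gram_minor i xs)" by (intro sum_nonneg gram_minor_nonneg)
    have "ennreal (gram_det xs) * ennreal (real n * (\<Sum>i<m. gram_minor i xs) / gram_det xs)
      = ennreal (gram_det xs * (real n * (\<Sum>i<m. gram_minor i xs) / gram_det xs))"
      by (rule ennreal_mult'[OF gram_det_nonneg, symmetric])
    \<comment> \<open>Only an inequality: where the determinant is 0 the quotient is 0 by
      convention.\<close>
    also have "\<dots> \<le> ennreal (real n * (\<Sum>i<m. gram_minor i xs))"
      using T by (intro ennreal_leI) simp
    also have "\<dots> = ennreal (real n) * (\<Sum>i<m. ennreal (gram_minor i xs))"
      by (subst sum_ennreal, rule gram_minor_nonneg, rule ennreal_mult[OF _ T]) simp
    finally have "ennreal (gram_det xs) * ennreal (real n * (\<Sum>i<m. gram_minor i xs) / gram_det xs) * indicator (bad \<delta>) xs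
      \<le> ennreal (real n) * (\<Sum>i<m. ennreal (gram_minor i xs)) * indicator (bad \<delta>) xs"
      by (rule mult_right_mono) simp
    then show "ennreal (gram_det xs) * (ennreal (real n * (\<Sum>i<m. gram_minor i xs) / gram_det xs) * indicator (bad \<delta>) xs)
      \<le> ennreal (real n) * (\<Sum>i<m. ennreal (gram_minor i xs) * indicator (bad \<delta>) xs)"
      by (simp only: mult.assoc sum_distrib_right)
  qed simp
  also have "(\<integral>\<^sup>+xs. ennreal (real n) * (\<Sum>i<m. ennreal (gram_minor i xs) * indicator (bad \<delta>) xs) \<partial>product)
     = ennreal (real n) * (\<Sum>i<m. \<integral>\<^sup>+xs. ennreal (gram_minor i xs) * indicator (bad \<delta>) xs \<partial>product)"
  proof -
    have m: "(\<lambda>xs. ennreal (gram_minor i xs) * indicator (bad \<delta>) xs) \<in> borel_measurable product" for i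
      by (intro borel_measurable_times_ennreal ind) measurable
    show ?thesis
      by (subst nn_integral_cmult, intro borel_measurable_sum m, subst nn_integral_sum, rule m, rule refl)
  qed
  also have "(\<Sum>i<m. \<integral>\<^sup>+xs. ennreal (gram_minor i xs) * indicator (bad \<delta>) xs \<partial>product)
     \<le> (\<Sum>i<m. ennreal (fact n / fact (n - (m - 1)) * ?\<epsilon>))"
    by (intro sum_mono nn_integral_gram_minor_bad \<delta>)
  also have "\<dots> = ennreal (real m * (fact n / fact (n - (m - 1)) * ?\<epsilon>))"
    by (subst sum_ennreal, simp, simp only: sum_constant card_lessThan)
  also have "ennreal ?K * (ennreal (real n) * ennreal (real m * (fact n / fact (n - (m - 1)) * ?\<epsilon>)))
     = ennreal (?K * (real n * (real m * (fact n / fact (n - (m - 1)) * ?\<epsilon>))))"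
    by (simp flip: ennreal_mult)
  also have "\<dots> \<le> ennreal 1"
  proof (rule ennreal_leI)
    \<comment> \<open>The quotient of factorials leaves 1 / (n - m + 1), which is simply bounded by
      1 at the end.\<close>
    have sub: "n - (m - 1) = Suc (n - m)" using m_pos m_less_n by simp
    have cancel: "x / y * (p * (q * (y / (z * x) * e))) = (p * q) * e / z"
      if "x \<noteq> 0" "y \<noteq> 0" for x y p q z e :: real
      using that by simp
    have "?K * (real n * (real m * (fact n / fact (n - (m - 1)) * ?\<epsilon>)))
       = (real n * real m) * ?\<epsilon> / real (Suc (n - m))"
      unfolding sub fact_Suc by (rule cancel) simp_all
    also have "\<dots> \<le> (real n * real m) * (1 / (real n * real m)) / real (Suc (n - m))"
      by (intro divide_right_mono mult_left_mono eps) auto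
    also have "\<dots> = 1 / real (Suc (n - m))" using m_pos m_less_n by simp
    also have "\<dots> \<le> 1" by simp
    finally show "?K * (real n * (real m * (fact n / fact (n - (m - 1)) * ?\<epsilon>))) \<le> 1" .
  qed
  finally show ?thesis by (simp add: mult_left_mono)
qed

lemma AE_sampled_sup_bound:
  assumes "esssup \<mu> (\<lambda>x. ereal (h x powr (-1/2) * \<bar>u x\<bar>)) \<le> ereal a"
  shows "AE xs in \<gamma>. \<forall>l<n. (u (xs l))\<^sup>2 \<le> a\<^sup>2 * h (xs l)"
proof (rule AE_gamma_components)
  have "AE x in \<mu>. ereal (h x powr (-1/2) * \<bar>u x\<bar>) \<le> esssup \<mu> (\<lambda>x. ereal (h x powr (-1/2) * \<bar>u x\<bar>))"
    by (rule esssup_AE)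
  then show "AE x in \<mu>. (u x)\<^sup>2 \<le> a\<^sup>2 * h x"
  proof eventually_elim
    case (elim x)
    have "h x powr (-1/2) * \<bar>u x\<bar> \<le> a"
      using order_trans[OF elim assms] by simp
    then have "(h x powr (-1/2) * \<bar>u x\<bar>)\<^sup>2 \<le> a\<^sup>2"
      by (intro power_mono) auto
    then have "(u x)\<^sup>2 / h x \<le> a\<^sup>2"
      using h_pos[of x] by (simp only: power_mult_distrib powr_neg_half_sq power2_abs) simp
    then show ?case using h_pos[of x] by (simp add: field_simps)
  qed
qed

text \<open>A whole sequence of approximants is treated at once so that a single event serves them
  all; with one event per approximant the limit could not be taken pointwise.\<close>

lemma wls_prob_bound:
  assumes \<delta>: "0 < \<delta>" "\<delta> < 1"
    and G: "\<And>j::nat. G j \<in> Vspace m \<phi>" "\<And>j. (\<lambda>x. f x - G j x) \<in> L2 \<mu>" "\<And>j. 0 \<le> a j"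
      "\<And>j. L2norm \<mu> (\<lambda>x. f x - G j x) \<le> C * a j"
      "\<And>j. esssup \<mu> (\<lambda>x. ereal (h x powr (-1/2) * \<bar>f x - G j x\<bar>)) \<le> ereal (a j)"
  shows "\<exists>E\<in>sets \<gamma>. measure \<gamma> E \<ge> 1 - real m * exp (- c_delta \<delta> * real (n - m) * \<alpha> / real m) \<and>
    (\<forall>xs\<in>E. \<forall>j. L2norm \<mu> (\<lambda>x. f x - wls_proj n m \<phi> w xs f x) \<le>
      (C + (1 - \<delta>) powr (-1/2) * (1 - \<alpha>) powr (-1/2) * (1 - real m / real n) powr (-1/2)) * a j)"
proof -
  let ?k = "(1 - \<delta>) powr (-1/2) * (1 - \<alpha>) powr (-1/2) * (1 - real m / real n) powr (-1/2)"
  let ?ok = "\<lambda>xs. 0 < gram_det xs \<and> (\<forall>j. \<forall>l<n. (f (xs l) - G j (xs l))\<^sup>2 \<le> (a j)\<^sup>2 * h (xs l))"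
  have "AE xs in \<gamma>. ?ok xs"
    using AE_gram_det_pos AE_sampled_sup_bound[OF G(5)] by (simp add: AE_all_countable)
  \<comment> \<open>A measurable null set covering the exceptional points for every j; removing it
    makes the error bounds hold everywhere on E and leaves the probability unchanged.\<close>
  then obtain N where N: "{xs \<in> space \<gamma>. \<not> ?ok xs} \<subseteq> N" "emeasure \<gamma> N = 0" "N \<in> sets \<gamma>"
    by (rule AE_E)
  have B: "bad \<delta> \<inter> space \<gamma> \<in> sets \<gamma>"
    using bad_measurable[of \<delta>] by (simp add: sets_gamma space_gamma pred_def Int_def conj_commute)
  define E where "E = space \<gamma> - ((bad \<delta> \<inter> space \<gamma>) \<union> N)"
  have E: "E \<in> sets \<gamma>" using B N(3) by (auto simp: E_def)
  have "measure \<gamma> ((bad \<delta> \<inter> space \<gamma>) \<union> N) = measure \<gamma> (bad \<delta> \<inter> space \<gamma>)"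
    using N B by (intro measure_Un_null_set) (auto simp: null_sets_def)
  then have "measure \<gamma> E = 1 - measure \<gamma> (bad \<delta> \<inter> space \<gamma>)"
    unfolding E_def using B N(3) by (subst G.prob_compl) auto
  then have "measure \<gamma> E \<ge> 1 - real m * exp (- c_delta \<delta> * real (n - m) * \<alpha> / real m)"
    using prob_bad_le[OF \<delta>] by linarith
  moreover have "L2norm \<mu> (\<lambda>x. f x - wls_proj n m \<phi> w xs f x) \<le> (C + ?k) * a j" if "xs \<in> E" for xs j
  proof -
    have xs: "xs \<notin> bad \<delta>" "?ok xs" using that N(1) by (auto simp: E_def)
    obtain r where r: "0 \<le> r" "r\<^sup>2 \<le> (a j)\<^sup>2 / (1 - \<alpha>) * (1 / (1 - \<delta>) * (1 / (1 - real m / real n)))"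
      "L2norm \<mu> (\<lambda>x. f x - wls_proj n m \<phi> w xs f x) \<le> L2norm \<mu> (\<lambda>x. f x - G j x) + r"
      by (rule wls_error_good[OF \<delta> _ xs(1) G(1) G(2), where a = "a j"]) (use xs(2) in auto)
    have mn: "0 < 1 - real m / real n" using m_less_n by simp
    have "?k\<^sup>2 = (1 / (1 - \<delta>)) * (1 / (1 - \<alpha>)) * (1 / (1 - real m / real n))"
      using \<delta> alpha mn by (simp only: power_mult_distrib powr_neg_half_sq diff_gt_0_iff_gt)
    then have "r\<^sup>2 \<le> (?k * a j)\<^sup>2"
      using r(2) by (simp only: power_mult_distrib) (simp add: mult_ac)
    then have "r \<le> ?k * a j" by (rule power2_le_imp_le) (simp add: G(3))
    then show ?thesis using r(3) G(4)[of j] by (simp only: distrib_right)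
  qed
  ultimately show ?thesis using E by blast
qed

text \<open>The factors 2 come from (s + r)^2 \<le> 2 s^2 + 2 r^2. On the good event r is bounded by
  a constant, on the bad one by a multiple of the minor ratio, whose integral is at most 1. The
  error is compared almost everywhere with the sum of both as a measurable majorant.\<close>

lemma wls_expectation_bound:
  assumes \<delta>: "0 < \<delta>" "\<delta> < 1"
    and n: "real n \<ge> real m + (1 / c_delta \<delta>) * (1 / \<alpha>) * real m * ln (real n * real m ^ 2)"
    and g: "g \<in> Vspace m \<phi>" "(\<lambda>x. f x - g x) \<in> L2 \<mu>" "0 \<le> a"
      "L2norm \<mu> (\<lambda>x. f x - g x) \<le> C * a"
      "esssup \<mu> (\<lambda>x. ereal (h x powr (-1/2) * \<bar>f x - g x\<bar>)) \<le> ereal a"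
  shows "(\<integral>\<^sup>+xs. ennreal ((L2norm \<mu> (\<lambda>x. f x - wls_proj n m \<phi> w xs f x))\<^sup>2) \<partial>\<gamma>)
    \<le> ennreal ((2 * C\<^sup>2 + 2 * (1 / (1 - \<alpha>)) * (1 + (1 / (1 - \<delta>)) * (1 / (1 - real m / real n)))) * a\<^sup>2)"
proof -
  let ?Q = "1 / (1 - \<delta>) * (1 / (1 - real m / real n))"
  let ?A = "a\<^sup>2 / (1 - \<alpha>)"
  let ?\<rho> = "\<lambda>xs. real n * (\<Sum>i<m. gram_minor i xs) / gram_det xs"
  let ?c = "2 * (C\<^sup>2 * a\<^sup>2) + 2 * (?A * ?Q)"
  have A0: "0 \<le> ?A" using alpha by simp
  have Q0: "0 \<le> ?Q" using \<delta> m_less_n by simp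
  have A2: "0 \<le> 2 * ?A" using A0 by simp
  have c0: "0 \<le> ?c"
    by (intro add_nonneg_nonneg mult_nonneg_nonneg A0 Q0 zero_le_power2 zero_le_numeral)
  have \<rho>0: "0 \<le> ?\<rho> xs" for xs
    by (intro divide_nonneg_nonneg mult_nonneg_nonneg sum_nonneg gram_minor_nonneg gram_det_nonneg) simp
  have u2: "(L2norm \<mu> (\<lambda>x. f x - g x))\<^sup>2 \<le> C\<^sup>2 * a\<^sup>2"
    using power_mono[OF g(4) L2norm_nonneg, of 2] by (simp add: power_mult_distrib)
  have sq: "L\<^sup>2 \<le> 2 * (C\<^sup>2 * a\<^sup>2) + 2 * b"
    if "0 \<le> L" "L \<le> L2norm \<mu> (\<lambda>x. f x - g x) + r" "r\<^sup>2 \<le> b" for L r b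
  proof -
    have "L\<^sup>2 \<le> (L2norm \<mu> (\<lambda>x. f x - g x) + r)\<^sup>2" using that by (intro power_mono) auto
    also have "\<dots> \<le> 2 * (L2norm \<mu> (\<lambda>x. f x - g x))\<^sup>2 + 2 * r\<^sup>2"
      using sum_squares_bound[of "L2norm \<mu> (\<lambda>x. f x - g x)" r] by (simp add: power2_sum)
    finally show ?thesis using u2 that(3) by linarith
  qed
  have "AE xs in \<gamma>. ennreal ((L2norm \<mu> (\<lambda>x. f x - wls_proj n m \<phi> w xs f x))\<^sup>2)
    \<le> ennreal ?c + ennreal (2 * ?A) * (ennreal (?\<rho> xs) * indicator (bad \<delta>) xs)"
    using AE_gram_det_pos AE_sampled_sup_bound[OF g(5)]
  proof eventually_elim
    case (elim xs)
    let ?L = "L2norm \<mu> (\<lambda>x. f x - wls_proj n m \<phi> w xs f x)"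
    show ?case
    proof (cases "xs \<in> bad \<delta>")
      case False
      obtain r where "0 \<le> r" "r\<^sup>2 \<le> ?A * ?Q" "?L \<le> L2norm \<mu> (\<lambda>x. f x - g x) + r"
        by (rule wls_error_good[OF \<delta> elim(1) False g(1,2), where a = a]) (use elim(2) in auto)
      then have "?L\<^sup>2 \<le> ?c" by (intro sq L2norm_nonneg)
      then show ?thesis using False by (simp add: ennreal_leI)
    next
      case True
      obtain r where "0 \<le> r" "r\<^sup>2 \<le> ?A * ?\<rho> xs" "?L \<le> L2norm \<mu> (\<lambda>x. f x - g x) + r"
        by (rule wls_error_bad[OF elim(1) g(1,2), where a = a]) (use elim(2) in auto)
      then have "?L\<^sup>2 \<le> 2 * (C\<^sup>2 * a\<^sup>2) + 2 * (?A * ?\<rho> xs)" by (intro sq L2norm_nonneg)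
      also have "\<dots> \<le> ?c + 2 * ?A * ?\<rho> xs"
        using mult_nonneg_nonneg[OF A0 Q0] by linarith
      finally have "ennreal (?L\<^sup>2) \<le> ennreal (?c + 2 * ?A * ?\<rho> xs)" by (rule ennreal_leI)
      also have "\<dots> = ennreal ?c + ennreal (2 * ?A) * ennreal (?\<rho> xs)"
        by (simp only: ennreal_plus[OF c0 mult_nonneg_nonneg[OF A2 \<rho>0[of xs]]] ennreal_mult[OF A2 \<rho>0[of xs]])
      finally show ?thesis using True by simp
    qed
  qed
  then have "(\<integral>\<^sup>+xs. ennreal ((L2norm \<mu> (\<lambda>x. f x - wls_proj n m \<phi> w xs f x))\<^sup>2) \<partial>\<gamma>)
    \<le> (\<integral>\<^sup>+xs. ennreal ?c + ennreal (2 * ?A) * (ennreal (?\<rho> xs) * indicator (bad \<delta>) xs) \<partial>\<gamma>)"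
    by (rule nn_integral_mono_AE)
  also have "\<dots> = ennreal ?c + ennreal (2 * ?A) * (\<integral>\<^sup>+xs. ennreal (?\<rho> xs) * indicator (bad \<delta>) xs \<partial>\<gamma>)"
  proof -
    have "indicator (bad \<delta>) \<in> borel_measurable product"
      using bad_measurable[of \<delta>] by (auto simp: borel_measurable_indicator_iff pred_def Int_def conj_commute)
    then have "(\<lambda>xs. ennreal (?\<rho> xs) * indicator (bad \<delta>) xs) \<in> borel_measurable product"
      by (intro borel_measurable_times_ennreal) measurable
    then have m: "(\<lambda>xs. ennreal (?\<rho> xs) * indicator (bad \<delta>) xs) \<in> borel_measurable \<gamma>"
      by (simp add: measurable_cong_sets[OF sets_gamma refl])
    show ?thesis
      by (subst nn_integral_add) (use m in \<open>auto simp: nn_integral_cmult G.emeasure_space_1\<close>)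
  qed
  also have "\<dots> \<le> ennreal ?c + ennreal (2 * ?A) * 1"
    by (intro add_left_mono mult_left_mono nn_integral_minor_ratio_le_1[OF \<delta> n]) simp
  also have "\<dots> = ennreal (?c + 2 * ?A)"
    using A0 mult_nonneg_nonneg[OF A0 Q0] by (simp add: ennreal_plus)
  also have "?c + 2 * ?A = (2 * C\<^sup>2 + 2 * (1 / (1 - \<alpha>)) * (1 + ?Q)) * a\<^sup>2"
    by (simp add: ring_distribs)
  finally show ?thesis .
qed

end

theorem mainTheorem11:
  fixes \<mu> :: "'a::polish_space measure" and \<phi> :: "nat \<Rightarrow> 'a \<Rightarrow> real" and m n :: nat
    and H :: "('a \<Rightarrow> real) set" and nH :: "('a \<Rightarrow> real) \<Rightarrow> real" and CH :: real
    and h :: "'a \<Rightarrow> real" and w :: "'a \<Rightarrow> real" and \<nu> :: "'a measure"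
    and \<gamma> :: "(nat \<Rightarrow> 'a) measure" and P :: "(nat \<Rightarrow> 'a) \<Rightarrow> 'a \<Rightarrow> real" and f :: "'a \<Rightarrow> real" and \<alpha> \<delta> :: real
  assumes "prob_space \<mu>" and "sets \<mu> = sets borel"
    and "0 < m" and "orthonormal_L2 \<mu> m \<phi>"
    and "h \<in> borel_measurable \<mu>" and "\<forall>x. 0 < h x" and "integrable \<mu> h" and "(\<integral>x. h x \<partial>\<mu>) = 1"
    and "embedding_space \<mu> H nH CH h"
    and "f \<in> H"
    and "0 < \<alpha>" and "\<alpha> < 1" and "m < n" and "0 < \<delta>" and "\<delta> < 1"
    and w_def: "w = (\<lambda>x. \<alpha> * wm m \<phi> x + (1 - \<alpha>) * h x)"
    and \<nu>_def: "\<nu> = density \<mu> (\<lambda>x. ennreal (w x))"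
    and \<gamma>_def: "\<gamma> = gamma_n n m \<phi> w \<nu>"
    and P_def: "P = (\<lambda>xs. wls_proj n m \<phi> w xs f)"
  shows "(\<exists>E\<in>sets \<gamma>.
            measure \<gamma> E \<ge> 1 - real m * exp (- c_delta \<delta> * real (n - m) * \<alpha> / real m) \<and>
            (\<forall>xs\<in>E. ennreal (L2norm \<mu> (\<lambda>x. f x - P xs x)) \<le>
               ennreal (CH + (1 - \<delta>) powr (-1/2) * (1 - \<alpha>) powr (-1/2) * (1 - real m / real n) powr (-1/2))
               * distH H nH (Vspace m \<phi>) f))
       \<and> (real n \<ge> real m + (1 / c_delta \<delta>) * (1 / \<alpha>) * real m * ln (real n * real m ^ 2) \<longrightarrow>
            (\<integral>\<^sup>+ xs. ennreal ((L2norm \<mu> (\<lambda>x. f x - P xs x))^2) \<partial>\<gamma>) \<le>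
               ennreal (2 * CH^2 + 2 * (1 / (1 - \<alpha>)) * (1 + (1 / (1 - \<delta>)) * (1 / (1 - real m / real n))))
               * (distH H nH (Vspace m \<phi>) f)^2)"
proof -
  interpret W: weighted_sampling \<mu> m n \<phi> h \<alpha>
    using assms by (intro weighted_sampling.intro weighted_sampling_axioms.intro) auto
  have eqs: "W.w = w" "W.\<nu> = \<nu>" "W.\<gamma> = \<gamma>"
    unfolding W.w_def W.\<nu>_def W.\<gamma>_def w_def \<nu>_def \<gamma>_def by simp_all
  let ?V = "Vspace m \<phi>"
  let ?F = "\<lambda>g. if (\<lambda>x. f x - g x) \<in> H then ennreal (nH (\<lambda>x. f x - g x)) else \<infinity>"
  let ?d = "distH H nH ?V f"
  define D where "D = enn2real ?d"
  have H_L2: "H \<subseteq> L2 \<mu>" and nH_nonneg: "\<And>u. u \<in> H \<Longrightarrow> 0 \<le> nH u"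
    and nH_L2: "\<And>u. u \<in> H \<Longrightarrow> L2norm \<mu> u \<le> CH * nH u"
    and nH_sup: "\<And>u. u \<in> H \<Longrightarrow> esssup \<mu> (\<lambda>x. ereal (h x powr (-1/2) * \<bar>u x\<bar>)) \<le> ereal (nH u)"
    using \<open>embedding_space \<mu> H nH CH h\<close> unfolding embedding_space_def by auto
  \<comment> \<open>Since f is in H, the competitor 0 makes the distance finite, so the limits below
    can be taken in the reals.\<close>
  have "?d \<le> ?F (\<lambda>x. 0)"
    unfolding distH_def by (rule INF_lower) (auto simp: Vspace_def intro!: exI[of _ "\<lambda>_. 0"])
  also have "\<dots> < \<infinity>" using \<open>f \<in> H\<close> by simp
  finally have d_fin: "?d < \<infinity>" .
  then have d: "?d = ennreal D" by (simp add: D_def)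
  have D0: "0 \<le> D" by (simp add: D_def)
  obtain G where G: "\<And>j. G j \<in> ?V" "\<And>j. ?F (G j) < \<infinity>" "\<And>j. enn2real (?F (G j)) \<le> D + 1 / real (Suc j)"
    using INF_approx_sequence[of ?F ?V] d_fin unfolding distH_def D_def by blast
  have GH: "(\<lambda>x. f x - G j x) \<in> H" for j
    using G(2)[of j] by (auto split: if_splits)
  define a where "a = (\<lambda>j. nH (\<lambda>x. f x - G j x))"
  have a0: "0 \<le> a j" for j unfolding a_def by (rule nH_nonneg[OF GH])
  have aD: "a j \<le> D + 1 / real (Suc j)" for j
    using G(3)[of j] GH[of j] a0[of j] by (simp add: a_def)
  have lim: "(\<lambda>j. D + 1 / real (Suc j)) \<longlonglongrightarrow> D"
    using tendsto_add[OF tendsto_const LIMSEQ_Suc[OF lim_1_over_n], of D] by simp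
  have aL2: "L2norm \<mu> (\<lambda>x. f x - G j x) \<le> CH * a j" for j
    unfolding a_def by (rule nH_L2[OF GH])
  have asup: "esssup \<mu> (\<lambda>x. ereal (h x powr (-1/2) * \<bar>f x - G j x\<bar>)) \<le> ereal (a j)" for j
    unfolding a_def by (rule nH_sup[OF GH])
  note bounds = G(1) subsetD[OF H_L2 GH] a0 aL2 asup
  let ?L = "\<lambda>xs. L2norm \<mu> (\<lambda>x. f x - P xs x)"
  let ?k = "CH + (1 - \<delta>) powr (-1/2) * (1 - \<alpha>) powr (-1/2) * (1 - real m / real n) powr (-1/2)"
  have "\<exists>E\<in>sets \<gamma>.
      measure \<gamma> E \<ge> 1 - real m * exp (- c_delta \<delta> * real (n - m) * \<alpha> / real m) \<and>
      (\<forall>xs\<in>E. \<forall>j. ?L xs \<le> ?k * a j)"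
    using W.wls_prob_bound[OF \<open>0 < \<delta>\<close> \<open>\<delta> < 1\<close> bounds]
    unfolding eqs P_def .
  moreover have "ennreal (?L xs) \<le> ennreal ?k * ?d" if L: "\<forall>j. ?L xs \<le> ?k * a j" for xs
  proof (cases "0 \<le> ?k")
    case True
    have "?L xs \<le> ?k * (D + 1 / real (Suc j))" for j
      using L[rule_format, of j] mult_left_mono[OF aD[of j] True] by linarith
    then have "?L xs \<le> ?k * D"
      by (intro LIMSEQ_le_const[OF tendsto_mult[OF tendsto_const lim]]) auto
    then show ?thesis unfolding d using D0 by (simp add: ennreal_leI flip: ennreal_mult'')
  next
    \<comment> \<open>\<open>CH\<close> may be negative, and \<open>ennreal\<close> truncates a
      negative constant to 0. The bound with j = 0 then forces the error to be at most 0 as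
      well.\<close>
    case False
    then have "?L xs \<le> 0"
      using L[rule_format, of 0] a0[of 0] mult_nonpos_nonneg[of ?k "a 0"] by linarith
    then show ?thesis by (simp add: ennreal_neg)
  qed
  moreover have "(\<integral>\<^sup>+ xs. ennreal ((?L xs)^2) \<partial>\<gamma>) \<le>
      ennreal (2 * CH^2 + 2 * (1 / (1 - \<alpha>)) * (1 + (1 / (1 - \<delta>)) * (1 / (1 - real m / real n)))) * ?d^2"
    if n: "real n \<ge> real m + (1 / c_delta \<delta>) * (1 / \<alpha>) * real m * ln (real n * real m ^ 2)"
  proof -
    let ?c = "2 * CH^2 + 2 * (1 / (1 - \<alpha>)) * (1 + (1 / (1 - \<delta>)) * (1 / (1 - real m / real n)))"
    have c0: "0 \<le> ?c"
      using \<open>\<alpha> < 1\<close> \<open>\<delta> < 1\<close> \<open>m < n\<close>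
      by (intro add_nonneg_nonneg mult_nonneg_nonneg divide_nonneg_nonneg) auto
    have "(\<integral>\<^sup>+ xs. ennreal ((?L xs)^2) \<partial>\<gamma>) \<le> ennreal (?c * (D + 1 / real (Suc j))^2)" for j
    proof -
      have "(\<integral>\<^sup>+ xs. ennreal ((?L xs)^2) \<partial>\<gamma>) \<le> ennreal (?c * (a j)^2)"
        using W.wls_expectation_bound[OF \<open>0 < \<delta>\<close> \<open>\<delta> < 1\<close> n bounds(1)[of j] bounds(2)[of j] bounds(3)[of j]
            bounds(4)[of j] bounds(5)[of j]]
        unfolding eqs P_def .
      also have "\<dots> \<le> ennreal (?c * (D + 1 / real (Suc j))^2)"
        by (intro ennreal_leI mult_left_mono power_mono aD a0 c0)
      finally show ?thesis .
    qed
    \<comment> \<open>The left side does not depend on j, so here the limit is taken in the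
      constants only and not under the integral.\<close>
    moreover have "(\<lambda>j. ennreal (?c * (D + 1 / real (Suc j))^2)) \<longlonglongrightarrow> ennreal (?c * D^2)"
      by (intro tendsto_ennrealI tendsto_mult tendsto_const tendsto_power lim)
    ultimately have "(\<integral>\<^sup>+ xs. ennreal ((?L xs)^2) \<partial>\<gamma>) \<le> ennreal (?c * D^2)"
      by (intro LIMSEQ_le_const) auto
    also have "\<dots> = ennreal ?c * ?d^2"
      unfolding d ennreal_power[OF D0] by (rule ennreal_mult[OF c0]) simp
    finally show ?thesis .
  qed
  ultimately show ?thesis by blast
qed

end
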